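(* For every integer \(r\ge 1\), let \(K_{3,3}^{\sqcup r}\) be the disjoint union of \(r\) copies of \(K_{3,3}\). Then \[ \operatorname{pf}\bigl(K_{3,3}^{\sqcup r}\bigr)\ge \left\lceil\left(\tfrac83\right)^r\right\rceil . \]
   Context: For a finite simple graph \(G\) on \(2n\) vertices, assign an independent variable \(x_e\) to each edge \(e\); the perfect-matching polynomial is \(\mathrm{PM}(G)=\sum_{M}\prod_{e\in M}x_e\) over all perfect matchings \(M\). Fix an ordering of the vertices. For an orientation \(D\) of \(G\), the weighted skew-adjacency matrix \(A_D\) has \((A_D)_{ij}=x_{ij}\) if \(ij\) is an edge oriented from \(i\) to \(j\), \(-x_{ij}\) if oriented from \(j\) to \(i\), and \(0\) if \(ij\) is not an edge; \(\mathrm{Pf}(A_D)\) is its Pfaffian. \(G\) is \(k\)-Pfaffian if there exist orientations \(D_1,\dots,D_k\) and reals \(c_1,\dots,c_k\) with \(\mathrm{PM}(G)=\sum_{i=1}^k c_i\,\mathrm{Pf}(A_{D_i})\) as polynomials; the Pfaffian number \(\operatorname{pf}(G)\) is the least positive integer \(k\) such that \(G\) is \(k\)-Pfaffian. *)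

theory Defs
  imports
    Complex_Main
    "HOL-Library.Poly_Mapping"
    "HOL-Combinatorics.Permutations"
    "Jordan_Normal_Form.Matrix"
begin

section \<open>Simple graphs and perfect matchings\<close>

type_synonym 'a graph = "'a set \<times> 'a set set"

abbreviation vertices :: "'a graph \<Rightarrow> 'a set" where "vertices \<equiv> fst"
abbreviation edges :: "'a graph \<Rightarrow> 'a set set" where "edges \<equiv> snd"

definition finite_simple_graph :: "'a graph \<Rightarrow> bool" where
  "finite_simple_graph G \<longleftrightarrow>
     finite (vertices G) \<and> (\<forall>e\<in>edges G. e \<subseteq> vertices G \<and> card e = 2)"

definition perfect_matchings :: "'a graph \<Rightarrow> 'a set set set" where
  "perfect_matchings G = {M. M \<subseteq> edges G \<and> (\<forall>v\<in>vertices G. \<exists>!e. e \<in> M \<and> v \<in> e)}"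

definition complete_bipartite :: "nat \<Rightarrow> nat \<Rightarrow> (nat + nat) graph" where
  "complete_bipartite m n =
     (Inl ` {..<m} \<union> Inr ` {..<n}, {{Inl i, Inr j} | i j. i < m \<and> j < n})"

text \<open>The disjoint union of \<open>r\<close> copies of a graph; the first component of a vertex is the
  index of the copy it lies in.\<close>

definition disjoint_copies :: "nat \<Rightarrow> 'a graph \<Rightarrow> (nat \<times> 'a) graph" where
  "disjoint_copies r G =
     ({..<r} \<times> vertices G, {Pair c ` e | c e. c < r \<and> e \<in> edges G})"

lemma finite_simple_graph_complete_bipartite: "finite_simple_graph (complete_bipartite m n)"
  by (auto simp: finite_simple_graph_def complete_bipartite_def)

lemma finite_simple_graph_disjoint_copies:
  assumes "finite_simple_graph G"
  shows "finite_simple_graph (disjoint_copies r G)"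
proof -
  have "card (Pair c ` e) = card e" for c :: nat and e :: "'a set"
    by (simp add: card_image inj_on_def)
  with assms show ?thesis
    by (fastforce simp: finite_simple_graph_def disjoint_copies_def)
qed


section \<open>The perfect-matching polynomial\<close>

text \<open>Real polynomials in indeterminates indexed by \<open>'e\<close>: monomials are the finitely supported
  exponent functions \<open>'e \<Rightarrow>\<^sub>0 nat\<close>, and a polynomial is a finitely supported
  family of coefficients. In the ring structure of \<open>HOL-Library.Poly_Mapping\<close>,
  multiplication is convolution, i.e. polynomial multiplication.\<close>

type_synonym 'e real_mpoly = "('e \<Rightarrow>\<^sub>0 nat) \<Rightarrow>\<^sub>0 real"

definition indet :: "'e \<Rightarrow> 'e real_mpoly" where
  "indet e = Poly_Mapping.single (Poly_Mapping.single e 1) 1"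

definition const_poly :: "real \<Rightarrow> 'e real_mpoly" where
  "const_poly c = Poly_Mapping.single 0 c"

definition PM :: "'a graph \<Rightarrow> 'a set real_mpoly" where
  "PM G = (\<Sum>M\<in>perfect_matchings G. \<Prod>e\<in>M. indet e)"


section \<open>Pfaffians\<close>

text \<open>The permutations \<open>p\<close> of \<open>{..<2 * n}\<close> below are the canonical
  representatives of the partitions of \<open>{..<2 * n}\<close> into the pairs
  \<open>{p (2 * i), p (2 * i + 1)}\<close>: each pair is listed in increasing order, and the pairs
  are listed by increasing first element.\<close>

definition pairings :: "nat \<Rightarrow> (nat \<Rightarrow> nat) set" where
  "pairings n = {p. p permutes {..<2 * n} \<and>
     (\<forall>i<n. p (2 * i) < p (2 * i + 1)) \<and>
     (\<forall>i j. i < j \<and> j < n \<longrightarrow> p (2 * i) < p (2 * j))}"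

definition pfaffian :: "'a::comm_ring_1 mat \<Rightarrow> 'a" where
  "pfaffian A = (if odd (dim_row A) then 0 else
     (\<Sum>p\<in>pairings (dim_row A div 2).
        of_int (sign p) * (\<Prod>i<dim_row A div 2. A $$ (p (2 * i), p (2 * i + 1)))))"


section \<open>Pfaffian number\<close>

text \<open>An orientation is a set of arcs containing exactly one of \<open>(u, v)\<close> and
  \<open>(v, u)\<close> for every edge \<open>{u, v}\<close>.\<close>

definition is_orientation :: "'a graph \<Rightarrow> ('a \<times> 'a) set \<Rightarrow> bool" where
  "is_orientation G D \<longleftrightarrow>
     (\<forall>(u, v)\<in>D. {u, v} \<in> edges G) \<and>
     (\<forall>u v. {u, v} \<in> edges G \<longrightarrow> ((u, v) \<in> D) \<noteq> ((v, u) \<in> D))"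

definition is_vertex_ordering :: "'a graph \<Rightarrow> 'a list \<Rightarrow> bool" where
  "is_vertex_ordering G vs \<longleftrightarrow> distinct vs \<and> set vs = vertices G"

definition skew_adjacency :: "'a list \<Rightarrow> ('a \<times> 'a) set \<Rightarrow> 'a set real_mpoly mat" where
  "skew_adjacency vs D = mat (length vs) (length vs) (\<lambda>(i, j).
     if (vs ! i, vs ! j) \<in> D then indet {vs ! i, vs ! j}
     else if (vs ! j, vs ! i) \<in> D then - indet {vs ! i, vs ! j}
     else 0)"

definition k_pfaffian :: "'a graph \<Rightarrow> 'a list \<Rightarrow> nat \<Rightarrow> bool" where
  "k_pfaffian G vs k \<longleftrightarrow>
     (\<exists>(D :: nat \<Rightarrow> ('a \<times> 'a) set) (c :: nat \<Rightarrow> real).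
        (\<forall>i<k. is_orientation G (D i)) \<and>
        PM G = (\<Sum>i<k. const_poly (c i) * pfaffian (skew_adjacency vs (D i))))"

definition pfaffian_number :: "'a graph \<Rightarrow> 'a list \<Rightarrow> nat" where
  "pfaffian_number G vs = (LEAST k. 0 < k \<and> k_pfaffian G vs k)"

end

theory Submission
  imports Defs
begin

text \<open>In the Pfaffian of an orientation \<open>D\<close>, the monomial of a perfect matching \<open>M\<close> has as
  coefficient a sign, which is multiplicative over disjoint unions of graphs up to a factor that
  depends only on the vertex ordering. For \<open>K\<^sub>3\<^sub>,\<^sub>3\<close> it yields sign vectors \<open>g\<close> on the six perfect
  matchings, and all of them have product \<open>-1\<close>. For an even set \<open>N\<close> of matchings consider the
  functional \<open>x \<mapsto> \<Sum>t. neg_on N t * x t\<close>. As \<open>card N \<noteq> 3\<close>, it does not vanish on the all-ones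
  vector, whereas for fixed \<open>g\<close> it is nonzero on \<open>g\<close> for only 12 of the 32 even sets \<open>N\<close>, since
  otherwise the symmetric difference of \<open>N\<close> with the negative set of \<open>g\<close> has size 3. If the
  all-ones tensor is a combination of \<open>k\<close> products of such vectors \<open>g\<close>, then for each of the
  \<open>32 ^ r\<close> product functionals one of the \<open>k\<close> terms survives, so \<open>32 ^ r \<le> k * 12 ^ r\<close>.

  The least \<open>k\<close> in the definition of the Pfaffian number is meaningful only if some \<open>k\<close> exists.
  One does because, up to signs, the coefficients of distinct matchings are distinct characters of
  the group of reorientations, hence orthogonal.\<close>

section \<open>Signs and inversions\<close>

text \<open>Equal arguments give \<open>-1\<close> instead of 0, so that every value squares to 1
  without side conditions.\<close>

definition cmp :: "'a::linorder \<Rightarrow> 'a \<Rightarrow> int" where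
  "cmp x y = (if x < y then 1 else - 1)"

lemma cmp_square [simp]: "cmp x y * cmp x y = 1"
  by (simp add: cmp_def)

lemma cmp_swap: "x \<noteq> y \<Longrightarrow> cmp y x = - cmp x y"
  by (auto simp: cmp_def)

text \<open>For a key \<open>k\<close> injective on \<open>A\<close> this has one ordered
  representative of each two-element subset of \<open>A\<close>. The keys used are \<open>id\<close>
  on indices and \<open>lo\<close> on edges.\<close>

definition increasing_pairs :: "('a \<Rightarrow> 'b::linorder) \<Rightarrow> 'a set \<Rightarrow> ('a \<times> 'a) set" where
  "increasing_pairs k A = {(x, y) \<in> A \<times> A. k x < k y}"

lemma finite_increasing_pairs [simp]: "finite A \<Longrightarrow> finite (increasing_pairs k A)"
  by (rule finite_subset[of _ "A \<times> A"]) (auto simp: increasing_pairs_def)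

text \<open>A symmetric factor depends only on the unordered pair, and a bijection carries unordered
  pairs to unordered pairs. The witnesses swap the images whenever the order is reversed.\<close>

lemma prod_increasing_pairs_reindex:
  assumes "bij_betw f A B" "inj_on k A" "inj_on k' B"
    and sym: "\<And>x y. x \<in> B \<Longrightarrow> y \<in> B \<Longrightarrow> x \<noteq> y \<Longrightarrow> h x y = h y x"
  shows "(\<Prod>(x, y)\<in>increasing_pairs k A. h (f x) (f y)) =
         (\<Prod>(x, y)\<in>increasing_pairs k' B. h x y)"
proof -
  define g where "g = the_inv_into A f"
  have fg: "f x \<in> B" "g (f x) = x" if "x \<in> A" for x
    using assms(1) that by (auto simp: g_def bij_betw_def the_inv_into_f_f)
  have gf: "g y \<in> A" "f (g y) = y" if "y \<in> B" for y
    using assms(1) that by (auto simp: g_def bij_betw_def f_the_inv_into_f the_inv_into_f_f)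
  have k: "k x \<noteq> k y" if "x \<in> A" "y \<in> A" "x \<noteq> y" for x y
    using assms(2) that by (auto dest: inj_onD)
  have k': "k' x \<noteq> k' y" if "x \<in> B" "y \<in> B" "x \<noteq> y" for x y
    using assms(3) that by (auto dest: inj_onD)
  show ?thesis
  proof (rule prod.reindex_bij_witness[of _
        "\<lambda>(x, y). if k (g x) < k (g y) then (g x, g y) else (g y, g x)"
        "\<lambda>(x, y). if k' (f x) < k' (f y) then (f x, f y) else (f y, f x)"], goal_cases)
    case (1 a)
    then show ?case by (auto simp: increasing_pairs_def fg split: if_splits)
  next
    case (2 a)
    then obtain x y where a: "a = (x, y)" "x \<in> A" "y \<in> A" "k x < k y"
      by (auto simp: increasing_pairs_def)
    moreover have "f x \<noteq> f y"
      using a fg by (metis less_irrefl)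
    ultimately show ?case
      using fg k'[of "f x" "f y"] by (auto simp: increasing_pairs_def)
  next
    case (3 b)
    then show ?case by (auto simp: increasing_pairs_def gf split: if_splits)
  next
    case (4 b)
    then obtain x y where b: "b = (x, y)" "x \<in> B" "y \<in> B" "k' x < k' y"
      by (auto simp: increasing_pairs_def)
    moreover have "g x \<noteq> g y"
      using b gf by (metis less_irrefl)
    ultimately show ?case
      using gf k[of "g x" "g y"] by (auto simp: increasing_pairs_def)
  next
    case (5 a)
    then obtain x y where a: "a = (x, y)" "x \<in> A" "y \<in> A" "k x < k y"
      by (auto simp: increasing_pairs_def)
    moreover have "f x \<noteq> f y"
      using a fg by (metis less_irrefl)
    ultimately show ?case
      using fg sym[of "f x" "f y"] by auto
  qed
qed

lemma prod_increasing_pairs_lessThan: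
  "(\<Prod>(u, v)\<in>increasing_pairs id {..<m::nat}. F u v) = (\<Prod>v<m. \<Prod>u<v. F u v)"
proof -
  have "(\<Prod>v<m. \<Prod>u<v. F u v) = (\<Prod>(v, u)\<in>(SIGMA v:{..<m}. {..<v}). F u v)"
    by (rule prod.Sigma) auto
  also have "\<dots> = (\<Prod>(u, v)\<in>increasing_pairs id {..<m}. F u v)"
    by (rule prod.reindex_bij_witness[of _ prod.swap prod.swap])
       (auto simp: increasing_pairs_def)
  finally show ?thesis ..
qed

lemma prod_minus_one_if:
  assumes "finite A"
  shows "(\<Prod>x\<in>A. if P x then - 1 else 1 :: 'a::comm_ring_1) = (- 1) ^ card {x \<in> A. P x}"
  using assms
proof (induction A rule: finite_induct)
  case (insert x A)
  have "{y \<in> insert x A. P y} = (if P x then insert x {y \<in> A. P y} else {y \<in> A. P y})"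
    by auto
  with insert show ?case by auto
qed simp

section \<open>The sign of a permutation as a product over inversions\<close>

text \<open>For a permutation \<open>p\<close> a factor is \<open>-1\<close> exactly at an
  inversion, so this is the parity of the number of inversions.\<close>

definition inv_sign :: "nat \<Rightarrow> (nat \<Rightarrow> nat) \<Rightarrow> int" where
  "inv_sign m p = (\<Prod>(i, j)\<in>increasing_pairs id {..<m}. cmp (p i) (p j))"

text \<open>The factor \<open>cmp (p x) (p y) * cmp x y\<close> is symmetric, as both comparisons
  change sign together. Its product over all pairs is therefore unchanged by reindexing along
  \<open>q\<close>.\<close>

lemma inv_sign_compose:
  assumes "p permutes {..<m}" "q permutes {..<m}"
  shows "inv_sign m (p \<circ> q) = inv_sign m p * inv_sign m q"
proof -
  let ?h = "\<lambda>x y. cmp (p x) (p y) * cmp x y"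
  have "(\<Prod>(i, j)\<in>increasing_pairs id {..<m}. ?h (q i) (q j)) =
        (\<Prod>(i, j)\<in>increasing_pairs id {..<m}. ?h i j)"
  proof (rule prod_increasing_pairs_reindex)
    show "bij_betw q {..<m} {..<m}"
      using assms(2) by (rule permutes_imp_bij)
    show "?h x y = ?h y x" if "x \<noteq> y" for x y
      using that permutes_inj[OF assms(1)] by (simp add: cmp_swap[of x y] cmp_swap[of "p x" "p y"] inj_eq)
  qed auto
  also have "(\<Prod>(i, j)\<in>increasing_pairs id {..<m}. ?h i j) = inv_sign m p"
    unfolding inv_sign_def
    by (rule prod.cong) (auto simp: increasing_pairs_def cmp_def)
  also have "(\<Prod>(i, j)\<in>increasing_pairs id {..<m}. ?h (q i) (q j)) =
      inv_sign m (p \<circ> q) * inv_sign m q"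
    unfolding inv_sign_def by (simp add: case_prod_unfold prod.distrib)
  finally have "inv_sign m (p \<circ> q) * inv_sign m q = inv_sign m p" .
  moreover have "inv_sign m q * inv_sign m q = 1"
    unfolding inv_sign_def
    by (simp add: case_prod_unfold flip: prod.distrib)
  ultimately show ?thesis
    by (metis mult.assoc mult.right_neutral)
qed

text \<open>The inversions are \<open>(a, b)\<close> together with \<open>(a, x)\<close> and
  \<open>(x, b)\<close> for each \<open>x\<close> strictly between, an odd number in all.\<close>

lemma inv_sign_transpose:
  assumes "a < b" "b < m"
  shows "inv_sign m (transpose a b) = - 1"
proof -
  let ?I = "{x \<in> increasing_pairs id {..<m}. \<not> transpose a b (fst x) < transpose a b (snd x)}"
  have "?I = insert (a, b) (Pair a ` {a<..<b} \<union> (\<lambda>x. (x, b)) ` {a<..<b})"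
    using assms by (auto simp: increasing_pairs_def transpose_def image_iff split: if_splits)
  moreover have "card (Pair a ` {a<..<b} \<union> (\<lambda>x. (x, b)) ` {a<..<b}) = 2 * card {a<..<b}"
    by (subst card_Un_disjoint) (auto simp: card_image inj_on_def)
  moreover have "(a, b) \<notin> Pair a ` {a<..<b} \<union> (\<lambda>x. (x, b)) ` {a<..<b}"
    by auto
  ultimately have "odd (card ?I)"
    by simp
  moreover have "inv_sign m (transpose a b) = (\<Prod>x\<in>increasing_pairs id {..<m}.
      if \<not> transpose a b (fst x) < transpose a b (snd x) then - 1 else 1)"
    unfolding inv_sign_def by (rule prod.cong) (auto simp: cmp_def)
  ultimately show ?thesis
    by (simp add: prod_minus_one_if)
qed

text \<open>Both sides are multiplicative and equal \<open>-1\<close> on transpositions, which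
  generate the permutations.\<close>

lemma sign_eq_inv_sign:
  assumes "p permutes {..<m}"
  shows "sign p = inv_sign m p"
  using assms finite_lessThan
proof (induction p rule: permutes_induct)
  case id
  show ?case
    unfolding inv_sign_def
    by (subst prod.neutral) (auto simp: increasing_pairs_def cmp_def)
next
  case (swap a b p)
  have t: "transpose a b permutes {..<m}"
    using swap by (intro permutes_swap_id)
  have "inv_sign m (transpose a b) = - 1"
    using swap inv_sign_transpose[of a b m] inv_sign_transpose[of b a m]
    by (metis lessThan_iff linorder_less_linear transpose_commute)
  moreover have "permutation (transpose a b)" "permutation p"
    using t swap by (auto simp: permutation_permutes)
  ultimately show ?case
    using swap t by (simp only: sign_compose inv_sign_compose sign_swap_id if_False)
qed

section \<open>Products over indices grouped into consecutive pairs\<close>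

lemma prod_lessThan_double:
  "(\<Prod>u<2 * n. f u) = (\<Prod>i<n::nat. f (2 * i) * f (2 * i + 1) :: 'a::comm_monoid_mult)"
  by (induction n) (simp_all add: mult_ac)

text \<open>Two indices lie either in one block \<open>{2 * j, 2 * j + 1}\<close> or in two
  different blocks, and two blocks contribute four pairs. For a pairing the blocks become edges and
  the four factors a crossing sign.\<close>

lemma prod_pairs_double:
  "(\<Prod>v<2 * n. \<Prod>u<v. F u v) =
   (\<Prod>j<n::nat. F (2 * j) (2 * j + 1)) *
   (\<Prod>j<n. \<Prod>i<j. F (2 * i) (2 * j) * F (2 * i) (2 * j + 1) *
      (F (2 * i + 1) (2 * j) * F (2 * i + 1) (2 * j + 1)) :: 'a::comm_monoid_mult)"
proof -
  have "(\<Prod>u<2 * j + 1. F u (2 * j + 1)) = F (2 * j) (2 * j + 1) * (\<Prod>u<2 * j. F u (2 * j + 1))" for j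
    by (simp add: mult.commute)
  then show ?thesis
    by (simp only: prod_lessThan_double prod.distrib) (simp only: mult_ac)
qed

section \<open>Counting\<close>

definition even_subsets :: "'a set \<Rightarrow> 'a set set" where
  "even_subsets A = {N. N \<subseteq> A \<and> even (card N)}"

lemma finite_even_subsets [simp]: "finite A \<Longrightarrow> finite (even_subsets A)"
  by (rule finite_subset[of _ "Pow A"]) (auto simp: even_subsets_def)

text \<open>The sizes 0, 2, 4, 6 contribute 1 + 15 + 15 + 1 sets.\<close>

lemma card_even_subsets_6:
  assumes "card A = 6"
  shows "card (even_subsets A) = 32"
proof -
  have fin: "finite A"
    using assms by (simp add: card_ge_0_finite)
  have "even_subsets A = (\<Union>k\<in>{0, 2, 4, 6}. {N. N \<subseteq> A \<and> card N = k})"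
  proof -
    have "card N \<in> {0, 2, 4, 6}" if "N \<subseteq> A" "even (card N)" for N
    proof -
      have "card N \<le> 6"
        using that card_mono[OF fin] assms by metis
      then have "card N \<in> {0, 1, 2, 3, 4, 5, 6}"
        by auto
      with that(2) show ?thesis by auto
    qed
    then show ?thesis
      unfolding even_subsets_def by fastforce
  qed
  also have "card \<dots> = (\<Sum>k\<in>{0, 2, 4, 6}. card {N. N \<subseteq> A \<and> card N = k})"
    by (rule card_UN_disjoint) (auto simp: fin)
  also have "\<dots> = 32"
    using fin assms by (simp add: n_subsets binomial_eq_0_iff numeral_eq_Suc)
  finally show ?thesis .
qed

text \<open>As a function of \<open>x\<close> this is the sign vector with negative set
  \<open>N\<close>; as a function of \<open>N\<close> it is a character of the group of sets under
  symmetric difference.\<close>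

definition neg_on :: "'a set \<Rightarrow> 'a \<Rightarrow> int" where
  "neg_on N x = (if x \<in> N then - 1 else 1)"

lemma neg_on_sym_diff: "neg_on (sym_diff M N) x = neg_on M x * neg_on N x"
  by (auto simp: neg_on_def)

lemma sum_neg_on:
  assumes "finite A" "N \<subseteq> A"
  shows "(\<Sum>x\<in>A. neg_on N x) = int (card A) - 2 * int (card N)"
proof -
  have "(\<Sum>x\<in>A. neg_on N x) = (\<Sum>x\<in>A. 1 - 2 * (if x \<in> N then 1 else 0))"
    by (rule sum.cong) (auto simp: neg_on_def)
  also have "\<dots> = int (card A) - 2 * (\<Sum>x\<in>A. if x \<in> N then 1 else 0)"
    by (simp add: sum_subtractf sum_distrib_left)
  also have "(\<Sum>x\<in>A. if x \<in> N then 1 else 0) = int (card N)"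
    using assms by (simp add: sum.If_cases Int_absorb1)
  finally show ?thesis .
qed

text \<open>The sum is \<open>6 - 2 * card N\<close>, which vanishes only for the odd size
  3.\<close>

lemma sum_neg_on_even_subset_neq_0:
  assumes "card A = 6" "N \<in> even_subsets A"
  shows "(\<Sum>x\<in>A. neg_on N x) \<noteq> 0"
proof
  assume "(\<Sum>x\<in>A. neg_on N x) = 0"
  moreover have "finite A"
    using assms by (simp add: card_ge_0_finite)
  ultimately have "card N = 3"
    using assms by (auto simp: sum_neg_on even_subsets_def)
  then show False
    using assms(2) by (simp add: even_subsets_def)
qed

text \<open>The negative set \<open>H\<close> of \<open>g\<close> has odd size, so for even
  \<open>N\<close> the set \<open>sym_diff N H\<close> has size 1, 3 or 5. The sum is 6 minus twice
  this size, hence nonzero only for 1 and 5. As \<open>N\<close> is determined by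
  \<open>sym_diff N H\<close>, at most 6 + 6 sets \<open>N\<close> remain.\<close>

lemma card_nonorthogonal_even_subsets:
  assumes A: "card A = 6" and g: "\<And>x. x \<in> A \<Longrightarrow> g x \<in> {1, - 1}" and "(\<Prod>x\<in>A. g x) = - 1"
  shows "card {N \<in> even_subsets A. (\<Sum>x\<in>A. neg_on N x * g x) \<noteq> (0::int)} \<le> 12"
proof -
  have fin: "finite A"
    using A by (simp add: card_ge_0_finite)
  define H where "H = {x \<in> A. g x = - 1}"
  have g_eq: "g x = neg_on H x" if "x \<in> A" for x
    using g[OF that] that by (auto simp: neg_on_def H_def)
  have H: "H \<subseteq> A" "finite H"
    using fin by (auto simp: H_def)
  have "(\<Prod>x\<in>A. g x) = (\<Prod>x\<in>A. if x \<in> H then - 1 else 1)"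
    by (rule prod.cong) (auto simp: g_eq neg_on_def)
  also have "\<dots> = (- 1) ^ card {x \<in> A. x \<in> H}"
    using fin by (rule prod_minus_one_if)
  also have "{x \<in> A. x \<in> H} = H"
    using H by auto
  finally have odd_H: "odd (card H)"
    using assms(3) by (metis neg_one_even_power neg_equal_zero one_neq_zero)
  let ?S = "{N \<in> even_subsets A. (\<Sum>x\<in>A. neg_on N x * g x) \<noteq> 0}"
  let ?T = "{N. N \<subseteq> A \<and> card N = 1} \<union> {N. N \<subseteq> A \<and> card N = 5}"
  have "card (sym_diff N H) \<in> {1, 5}" if "N \<in> ?S" for N
  proof -
    have N: "N \<subseteq> A" "even (card N)" "finite N"
      using that fin by (auto simp: even_subsets_def intro: finite_subset)
    have "(\<Sum>x\<in>A. neg_on N x * g x) = (\<Sum>x\<in>A. neg_on (sym_diff N H) x)"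
      by (rule sum.cong) (auto simp: neg_on_sym_diff[of N H] g_eq)
    also have "\<dots> = 6 - 2 * int (card (sym_diff N H))"
      using N H fin A by (subst sum_neg_on) auto
    finally have "card (sym_diff N H) \<noteq> 3"
      using that by auto
    moreover have "card (sym_diff N H) + 2 * card (N \<inter> H) = card N + card H"
    proof -
      have "card (sym_diff N H) = card (N - H) + card (H - N)"
        using N H by (intro card_Un_disjoint) auto
      moreover have "card (N - H) + card (N \<inter> H) = card N"
        using N by (metis add.commute card_Diff_subset_Int card_Int_Diff finite_Int)
      moreover have "card (H - N) + card (N \<inter> H) = card H"
        using H by (metis Int_commute add.commute card_Int_Diff)
      ultimately show ?thesis by simp
    qed
    then have "odd (card (sym_diff N H))"
      using N odd_H by (metis even_add dvd_triv_left)
    moreover have "card (sym_diff N H) \<le> 6"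
      using N H A card_mono[OF fin, of "sym_diff N H"] by auto
    then have "card (sym_diff N H) \<in> {0, 1, 2, 3, 4, 5, 6}"
      by auto
    ultimately show ?thesis by auto
  qed
  then have "(\<lambda>N. sym_diff N H) ` ?S \<subseteq> ?T"
    using H by (auto simp: even_subsets_def)
  moreover have "inj_on (\<lambda>N. sym_diff N H) ?S"
    by (rule inj_onI) blast
  moreover have "finite ?T"
    using fin by simp
  ultimately have "card ?S \<le> card ?T"
    by (meson card_inj_on_le)
  also have "\<dots> = 12"
    using fin A by (subst card_Un_disjoint) (auto simp: n_subsets numeral_eq_Suc)
  finally show ?thesis .
qed

section \<open>Pfaffians as signed sums over perfect matchings\<close>

definition edge_monomial :: "'e set \<Rightarrow> 'e \<Rightarrow>\<^sub>0 nat" where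
  "edge_monomial M = (\<Sum>e\<in>M. Poly_Mapping.single e 1)"

lemma prod_indet: "(\<Prod>e\<in>M. indet e) = Poly_Mapping.single (edge_monomial M) 1"
  unfolding edge_monomial_def
  by (induction M rule: infinite_finite_induct) (simp_all add: indet_def mult_single)

lemma edge_monomial_inject:
  assumes "finite M" "finite N"
  shows "edge_monomial M = edge_monomial N \<longleftrightarrow> M = N"
proof
  assume eq: "edge_monomial M = edge_monomial N"
  have "Poly_Mapping.lookup (edge_monomial A) e = (if e \<in> A then 1 else 0)" if "finite A" for A :: "'a set" and e
    using that by (simp add: edge_monomial_def lookup_sum lookup_single when_def)
  then show "M = N"
    using assms eq by (metis (no_types, opaque_lifting) subsetI subset_antisym zero_neq_one)
qed simp

text \<open>Distinct finite edge sets have distinct monomials, so the coefficient at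
  \<open>edge_monomial M\<close> sees the summand of \<open>M\<close> alone.\<close>

lemma sum_single_edge_monomial_eq_iff:
  assumes "finite S" "\<And>M. M \<in> S \<Longrightarrow> finite M"
  shows "(\<Sum>M\<in>S. Poly_Mapping.single (edge_monomial M) (a M)) =
         (\<Sum>M\<in>S. Poly_Mapping.single (edge_monomial M) (b M)) \<longleftrightarrow> (\<forall>M\<in>S. a M = b M)"
    (is "?A a = ?A b \<longleftrightarrow> _")
proof
  have lookup: "Poly_Mapping.lookup (?A c) (edge_monomial M) = c M" if "M \<in> S" for c M
  proof -
    have "Poly_Mapping.lookup (?A c) (edge_monomial M) = (\<Sum>N\<in>S. if N = M then c N else 0)"
      unfolding lookup_sum
      by (rule sum.cong) (use assms that in \<open>auto simp: lookup_single when_def edge_monomial_inject\<close>)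
    then show ?thesis
      using that assms by simp
  qed
  show "\<forall>M\<in>S. a M = b M" if "?A a = ?A b"
    using that lookup by metis
qed simp

section \<open>Positions of vertices and edges in the vertex ordering\<close>

locale ordered_graph =
  fixes G :: "'a graph" and vs :: "'a list" and n :: nat
  assumes graph: "finite_simple_graph G"
    and ordering: "is_vertex_ordering G vs"
    and length_vs: "length vs = 2 * n"
begin

text \<open>All signs compare positions, so the vertex type itself carries no order.\<close>

definition pos :: "'a \<Rightarrow> nat" where
  "pos = the_inv_into {..<2 * n} ((!) vs)"

lemma distinct_vs: "distinct vs" and set_vs: "set vs = vertices G"
  using ordering by (auto simp: is_vertex_ordering_def)

lemma pos_nth [simp]: "i < 2 * n \<Longrightarrow> pos (vs ! i) = i"
  unfolding pos_def
  by (rule the_inv_into_f_f) (use distinct_vs length_vs in \<open>auto simp: inj_on_def nth_eq_iff_index_eq\<close>)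

lemma nth_eq_iff: "i < 2 * n \<Longrightarrow> j < 2 * n \<Longrightarrow> vs ! i = vs ! j \<longleftrightarrow> i = j"
  using distinct_vs length_vs by (simp add: nth_eq_iff_index_eq)

lemma nth_in_vertices: "i < 2 * n \<Longrightarrow> vs ! i \<in> vertices G"
  using set_vs length_vs by (metis nth_mem)

lemma vertexE:
  assumes "v \<in> vertices G"
  obtains i where "i < 2 * n" "v = vs ! i"
  using assms set_vs length_vs by (metis in_set_conv_nth)

lemma pos_less: "v \<in> vertices G \<Longrightarrow> pos v < 2 * n"
  and nth_pos: "v \<in> vertices G \<Longrightarrow> vs ! pos v = v"
  by (auto elim!: vertexE)

lemma pos_eq_iff: "u \<in> vertices G \<Longrightarrow> v \<in> vertices G \<Longrightarrow> pos u = pos v \<longleftrightarrow> u = v"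
  using nth_pos by metis

text \<open>\<open>lo\<close> and \<open>hi\<close> recover the ordered pair of positions from an
  unordered edge; \<open>lo\<close> also serves as the key that orders the edges of a
  matching.\<close>

definition lo :: "'a set \<Rightarrow> nat" where "lo e = Min (pos ` e)"
definition hi :: "'a set \<Rightarrow> nat" where "hi e = Max (pos ` e)"

lemma lo_hi_nth:
  assumes "i < j" "j < 2 * n"
  shows "lo {vs ! i, vs ! j} = i" "hi {vs ! i, vs ! j} = j"
  using assms by (auto simp: lo_def hi_def)

lemma edge_subset: "e \<in> edges G \<Longrightarrow> e \<subseteq> vertices G"
  and card_edge: "e \<in> edges G \<Longrightarrow> card e = 2"
  using graph by (auto simp: finite_simple_graph_def)

lemma finite_edge: "e \<in> edges G \<Longrightarrow> finite e"
  by (rule card_ge_0_finite) (simp add: card_edge)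

lemma finite_edges: "finite (edges G)"
proof (rule finite_subset)
  show "edges G \<subseteq> Pow (vertices G)"
    using edge_subset by auto
qed (use graph in \<open>auto simp: finite_simple_graph_def\<close>)

lemma edgeE:
  assumes "e \<in> edges G"
  obtains i j where "i < j" "j < 2 * n" "e = {vs ! i, vs ! j}"
proof -
  obtain u v where e: "e = {u, v}" "u \<noteq> v"
    using card_edge[OF assms] by (auto simp: card_2_iff)
  obtain i j where ij: "i < 2 * n" "u = vs ! i" "j < 2 * n" "v = vs ! j"
    using edge_subset[OF assms] e by (auto elim!: vertexE)
  show ?thesis
  proof (cases "i < j")
    case True
    with that[of i j] ij e show ?thesis by auto
  next
    case False
    with that[of j i] ij e show ?thesis
      by (metis insert_commute linorder_neqE_nat)
  qed
qed

lemma edge_eq: "e \<in> edges G \<Longrightarrow> {vs ! lo e, vs ! hi e} = e"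
  and lo_less_hi: "e \<in> edges G \<Longrightarrow> lo e < hi e"
  and hi_less: "e \<in> edges G \<Longrightarrow> hi e < 2 * n"
  by (auto elim!: edgeE simp: lo_hi_nth)

lemma lo_less: "e \<in> edges G \<Longrightarrow> lo e < 2 * n"
  using lo_less_hi hi_less by fastforce

section \<open>Matchings, crossings and signs\<close>

definition matching :: "'a set set \<Rightarrow> bool" where
  "matching M \<longleftrightarrow> M \<subseteq> edges G \<and> (\<forall>e\<in>M. \<forall>f\<in>M. e \<noteq> f \<longrightarrow> e \<inter> f = {})"

text \<open>A matching need not cover all vertices, so the part of a perfect matching in one copy is
  again a matching.\<close>

lemma matching_subset: "matching M \<Longrightarrow> N \<subseteq> M \<Longrightarrow> matching N"
  unfolding matching_def by blast

lemma finite_matching: "matching M \<Longrightarrow> finite M"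
  using finite_edges by (auto simp: matching_def intro: finite_subset)

lemma perfect_matching_imp_matching:
  assumes "M \<in> perfect_matchings G"
  shows "matching M"
proof -
  have "e = f" if "e \<in> M" "f \<in> M" "v \<in> e" "v \<in> f" for e f v
  proof -
    have "v \<in> vertices G"
      using that assms edge_subset by (auto simp: perfect_matchings_def)
    then have "\<exists>!e. e \<in> M \<and> v \<in> e"
      using assms by (auto simp: perfect_matchings_def)
    with that show ?thesis by auto
  qed
  then show ?thesis
    using assms by (auto simp: matching_def perfect_matchings_def)
qed

lemma finite_perfect_matchings: "finite (perfect_matchings G)"
  by (rule finite_subset[of _ "Pow (edges G)"])
     (auto simp: perfect_matchings_def finite_edges)

lemma inj_on_lo: "matching M \<Longrightarrow> inj_on lo M"
proof (rule inj_onI)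
  fix e f assume M: "matching M" "e \<in> M" "f \<in> M" "lo e = lo f"
  then have "vs ! lo e \<in> e" "vs ! lo f \<in> f"
    using edge_eq[of e] edge_eq[of f] unfolding matching_def by blast+
  with M have "e \<inter> f \<noteq> {}"
    by auto
  with M show "e = f"
    unfolding matching_def by blast
qed

text \<open>For disjoint edges \<open>cross e f\<close> is \<open>-1\<close> exactly if the arcs \<open>e\<close> and \<open>f\<close>,
  drawn above a line carrying the ordered vertices, cross.\<close>

definition cross :: "'a set \<Rightarrow> 'a set \<Rightarrow> int" where
  "cross e f = (\<Prod>u\<in>e. \<Prod>v\<in>f. cmp (pos u) (pos v))"

text \<open>Exchanging the arguments negates each of the four comparisons; disjointness guarantees
  that the compared positions differ.\<close>

lemma cross_commute:
  assumes "e \<in> edges G" "f \<in> edges G" "e \<inter> f = {}"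
  shows "cross e f = cross f e"
proof -
  have "cross f e = (\<Prod>u\<in>e. \<Prod>v\<in>f. cmp (pos v) (pos u))"
    unfolding cross_def by (rule prod.swap)
  also have "\<dots> = (\<Prod>u\<in>e. \<Prod>v\<in>f. - cmp (pos u) (pos v))"
  proof (intro prod.cong refl)
    fix u v assume "u \<in> e" "v \<in> f"
    then have "pos u \<noteq> pos v"
      using assms edge_subset by (subst pos_eq_iff) auto
    then show "cmp (pos v) (pos u) = - cmp (pos u) (pos v)"
      by (rule cmp_swap)
  qed
  also have "\<dots> = cross e f"
    using card_edge assms by (simp add: cross_def prod_uminus)
  finally show ?thesis ..
qed

lemma cross_commute_matching:
  "matching M \<Longrightarrow> e \<in> M \<Longrightarrow> f \<in> M \<Longrightarrow> e \<noteq> f \<Longrightarrow> cross e f = cross f e"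
  by (rule cross_commute) (auto simp: matching_def)

text \<open>For a matching this is the parity of its number of crossings, and for a perfect one the
  sign of its canonical pairing.\<close>

definition matching_sign :: "'a set set \<Rightarrow> int" where
  "matching_sign M = (\<Prod>(e, f)\<in>increasing_pairs lo M. cross e f)"

text \<open>On an edge this is the sign of its entry above the diagonal of the skew-adjacency matrix
  of an orientation \<open>D\<close>.\<close>

definition arc_sign :: "('a \<times> 'a) set \<Rightarrow> 'a set \<Rightarrow> int" where
  "arc_sign D e = (if (vs ! lo e, vs ! hi e) \<in> D then 1 else - 1)"

definition pfaffian_sign :: "('a \<times> 'a) set \<Rightarrow> 'a set set \<Rightarrow> int" where
  "pfaffian_sign D M = matching_sign M * (\<Prod>e\<in>M. arc_sign D e)"

lemma matching_sign_square: "matching_sign M * matching_sign M = 1"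
  by (simp add: matching_sign_def cross_def case_prod_unfold flip: prod.distrib)

section \<open>Perfect matchings as canonical pairings of positions\<close>

definition edge_at :: "(nat \<Rightarrow> nat) \<Rightarrow> nat \<Rightarrow> 'a set" where
  "edge_at p i = {vs ! p (2 * i), vs ! p (2 * i + 1)}"

definition edge_pairings :: "(nat \<Rightarrow> nat) set" where
  "edge_pairings = {p \<in> pairings n. \<forall>i<n. edge_at p i \<in> edges G}"

lemma pairingsD:
  assumes "p \<in> pairings n"
  shows "p permutes {..<2 * n}" "\<And>k. k < 2 * n \<Longrightarrow> p k < 2 * n"
    "\<And>i. i < n \<Longrightarrow> p (2 * i) < p (2 * i + 1)"
    "\<And>i j. i < j \<Longrightarrow> j < n \<Longrightarrow> p (2 * i) < p (2 * j)"
proof -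
  show p: "p permutes {..<2 * n}"
    using assms by (simp add: pairings_def)
  show "p k < 2 * n" if "k < 2 * n" for k
    using that permutes_in_image[OF p] by simp
qed (use assms in \<open>auto simp: pairings_def\<close>)

lemma lo_hi_edge_at:
  assumes "p \<in> pairings n" "i < n"
  shows "lo (edge_at p i) = p (2 * i)" "hi (edge_at p i) = p (2 * i + 1)"
  using pairingsD[OF assms(1)] assms(2) by (simp_all add: edge_at_def lo_hi_nth)

lemma nth_in_edge_at_iff:
  assumes "p \<in> pairings n" "k < 2 * n" "i < n"
  shows "vs ! p k \<in> edge_at p i \<longleftrightarrow> i = k div 2"
proof -
  have "vs ! p k \<in> edge_at p i \<longleftrightarrow> p k = p (2 * i) \<or> p k = p (2 * i + 1)"
    using assms pairingsD(2)[OF assms(1)] by (simp add: edge_at_def nth_eq_iff)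
  also have "\<dots> \<longleftrightarrow> k = 2 * i \<or> k = 2 * i + 1"
    using permutes_inj[OF pairingsD(1)[OF assms(1)]] by (simp add: inj_eq)
  also have "\<dots> \<longleftrightarrow> i = k div 2"
    by auto
  finally show ?thesis .
qed

lemma inj_on_edge_at:
  assumes "p \<in> pairings n"
  shows "inj_on (edge_at p) {..<n}"
proof (rule inj_onI)
  fix i j assume "i \<in> {..<n}" "j \<in> {..<n}" "edge_at p i = edge_at p j"
  then have "p (2 * i) = p (2 * j)"
    using lo_hi_edge_at(1)[OF assms] by (metis lessThan_iff)
  then show "i = j"
    using permutes_inj[OF pairingsD(1)[OF assms]] by (simp add: inj_eq)
qed

lemma perfect_matching_edge_at:
  assumes "p \<in> edge_pairings"
  shows "edge_at p ` {..<n} \<in> perfect_matchings G"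
proof -
  have p: "p \<in> pairings n"
    using assms by (simp add: edge_pairings_def)
  have "\<exists>!e. e \<in> edge_at p ` {..<n} \<and> v \<in> e" if v: "v \<in> vertices G" for v
  proof -
    have "pos v \<in> p ` {..<2 * n}"
      using permutes_image[OF pairingsD(1)[OF p]] pos_less[OF v] by simp
    then obtain k where k: "k < 2 * n" "v = vs ! p k"
      using nth_pos[OF v] by force
    then show ?thesis
      using nth_in_edge_at_iff[OF p k(1)] by (auto intro!: ex1I[of _ "edge_at p (k div 2)"])
  qed
  then show ?thesis
    using assms by (auto simp: perfect_matchings_def edge_pairings_def)
qed

text \<open>The values at even indices are the lower ends of the edges in increasing order, so the
  edge set determines them. Each lower end determines its edge and thereby the value at the next odd
  index.\<close>

lemma pairing_determined_by_edges:
  assumes p: "p \<in> pairings n" and q: "q \<in> pairings n"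
    and eq: "edge_at p ` {..<n} = edge_at q ` {..<n}"
  shows "p = q"
proof -
  have sorted: "map (\<lambda>i. r (2 * i)) [0..<n] = sorted_list_of_set (lo ` edge_at r ` {..<n})"
    if "r \<in> pairings n" for r
  proof (rule strict_sorted_equal)
    show "sorted_wrt (<) (map (\<lambda>i. r (2 * i)) [0..<n])"
      using pairingsD(4)[OF that] by (auto simp: sorted_wrt_map sorted_wrt_iff_nth_less)
    have "lo ` edge_at r ` {..<n} = (\<lambda>i. r (2 * i)) ` {..<n}"
      unfolding image_image using lo_hi_edge_at(1)[OF that] by (intro image_cong) auto
    then show "set (map (\<lambda>i. r (2 * i)) [0..<n]) = set (sorted_list_of_set (lo ` edge_at r ` {..<n}))"
      by (simp add: lessThan_atLeast0)
  qed simp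
  have even: "p (2 * i) = q (2 * i)" if "i < n" for i
    using sorted[OF p] sorted[OF q] eq that
    by (metis (no_types, lifting) add.left_neutral diff_zero length_map length_upt nth_map nth_upt)
  have odd: "p (2 * i + 1) = q (2 * i + 1)" if "i < n" for i
  proof -
    have "edge_at p i \<in> edge_at q ` {..<n}"
      unfolding eq[symmetric] using that by simp
    then obtain j where j: "j < n" "edge_at p i = edge_at q j"
      by auto
    then have "q (2 * i) = q (2 * j)"
      using lo_hi_edge_at(1) p q that even by metis
    then have "i = j"
      using permutes_inj[OF pairingsD(1)[OF q]] by (simp add: inj_eq)
    with j show ?thesis
      using lo_hi_edge_at(2) p q by metis
  qed
  show ?thesis
  proof
    fix k
    show "p k = q k"
    proof (cases "k < 2 * n")
      case True
      then show ?thesis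
        using even[of "k div 2"] odd[of "k div 2"]
        by (cases "even k") (auto elim!: evenE oddE)
    next
      case False
      then show ?thesis
        using pairingsD(1)[OF p] pairingsD(1)[OF q] by (simp add: permutes_not_in)
    qed
  qed
qed

lemma card_perfect_matching:
  assumes "M \<in> perfect_matchings G"
  shows "card M = n"
proof -
  have M: "matching M"
    using assms by (rule perfect_matching_imp_matching)
  have "2 * card M = (\<Sum>e\<in>M. card e)"
    using M card_edge by (subst sum.cong[of M M card "\<lambda>_. 2"]) (auto simp: matching_def)
  also have "\<dots> = card (\<Union>M)"
    using M finite_edge by (intro card_Union_disjoint[symmetric])
      (auto simp: matching_def pairwise_def disjnt_def)
  also have "\<Union>M = vertices G"
    using assms edge_subset by (fastforce simp: perfect_matchings_def)
  also have "card \<dots> = 2 * n"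
    using set_vs distinct_vs length_vs by (metis distinct_card)
  finally show ?thesis by simp
qed

text \<open>Sorting the edges by lower end and listing the two ends of each edge in turn gives the
  pairing.\<close>

lemma perfect_matching_obtains_pairing:
  assumes "M \<in> perfect_matchings G"
  obtains p where "p \<in> edge_pairings" "M = edge_at p ` {..<n}"
proof -
  have M: "matching M" "M \<subseteq> edges G"
    using perfect_matching_imp_matching[OF assms] by (auto simp: matching_def)
  define l where "l = sorted_list_of_set (lo ` M)"
  have card_lo: "card (lo ` M) = n"
    using inj_on_lo[OF M(1)] card_perfect_matching[OF assms] by (simp add: card_image)
  have len: "length l = n"
    by (simp add: l_def card_lo)
  have set_l: "set l = lo ` M"
    using finite_matching[OF M(1)] by (simp add: l_def)
  have sorted_l: "l ! i < l ! j" if "i < j" "j < n" for i j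
    using that len strict_sorted_list_of_set[of "lo ` M"]
    by (simp add: l_def sorted_wrt_iff_nth_less)
  define g where "g i = the_inv_into M lo (l ! i)" for i
  have g: "g i \<in> M" "lo (g i) = l ! i" if "i < n" for i
  proof -
    have "l ! i \<in> lo ` M"
      using that len set_l by (metis nth_mem)
    then show "g i \<in> M" "lo (g i) = l ! i"
      using inj_on_lo[OF M(1)] by (auto simp: g_def the_inv_into_f_f)
  qed
  have g_surj: "\<exists>i<n. e = g i" if "e \<in> M" for e
  proof -
    have "lo e \<in> set l"
      using that set_l by simp
    then obtain i where i: "i < n" "lo e = l ! i"
      using len by (metis in_set_conv_nth)
    then have "e = g i"
      using g[of i] that inj_on_lo[OF M(1)] by (metis inj_onD)
    with i show ?thesis by blast
  qed
  \<comment> \<open>Here \<open>g i\<close> is the edge with the \<open>i\<close>-th smallest lower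
    end; outside the range \<open>p\<close> is the identity, as \<open>permutes\<close>
    demands.\<close>
  define p where "p k = (if k < 2 * n then
      if even k then lo (g (k div 2)) else hi (g (k div 2)) else k)" for k
  have p: "p (2 * i) = lo (g i)" "p (2 * i + 1) = hi (g i)" if "i < n" for i
    using that by (auto simp: p_def)
  have edge_at: "edge_at p i = g i" if "i < n" for i
    using p[OF that] edge_eq[of "g i"] g[OF that] M by (auto simp: edge_at_def)
  \<comment> \<open>Every vertex is covered by some edge, which gives surjectivity; on a finite set
    injectivity follows.\<close>
  have "{..<2 * n} \<subseteq> p ` {..<2 * n}"
  proof
    fix k assume "k \<in> {..<2 * n}"
    then have k: "k < 2 * n" by simp
    then obtain e where e: "e \<in> M" "vs ! k \<in> e"
      using assms nth_in_vertices[OF k] by (auto simp: perfect_matchings_def)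
    then obtain i where i: "i < n" "e = g i"
      using g_surj by blast
    have "vs ! k = vs ! lo e \<or> vs ! k = vs ! hi e"
      using e M edge_eq[of e] by auto
    then have "k = lo e \<or> k = hi e"
      using k e M lo_less[of e] hi_less[of e] by (auto simp: nth_eq_iff)
    then have "k = p (2 * i) \<or> k = p (2 * i + 1)"
      using p i(1) unfolding i(2) by simp
    then show "k \<in> p ` {..<2 * n}"
      using i by auto
  qed
  moreover have "p ` {..<2 * n} \<subseteq> {..<2 * n}"
  proof -
    have "p k < 2 * n" if "k < 2 * n" for k
    proof -
      have "g (k div 2) \<in> edges G"
        using g(1)[of "k div 2"] M that by auto
      then show ?thesis
        using lo_less hi_less that by (simp add: p_def)
    qed
    then show ?thesis by auto
  qed
  ultimately have "p ` {..<2 * n} = {..<2 * n}"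
    by blast
  then have "bij_betw p {..<2 * n} {..<2 * n}"
    by (simp add: bij_betw_def eq_card_imp_inj_on)
  then have "p permutes {..<2 * n}"
    by (rule bij_imp_permutes) (simp add: p_def)
  moreover have "p (2 * i) < p (2 * i + 1)" if "i < n" for i
    using p[OF that] g(1)[OF that] M lo_less_hi[of "g i"] by auto
  moreover have "p (2 * i) < p (2 * j)" if "i < j" "j < n" for i j
    using p(1) g(2) sorted_l[OF that] that by simp
  ultimately have "p \<in> edge_pairings"
    using edge_at g(1) M by (auto simp: edge_pairings_def pairings_def)
  moreover have "M = edge_at p ` {..<n}"
    using edge_at g(1) g_surj by (fastforce simp: image_iff)
  ultimately show ?thesis
    by (rule that)
qed

lemma bij_betw_edge_pairings:
  "bij_betw (\<lambda>p. edge_at p ` {..<n}) edge_pairings (perfect_matchings G)"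
proof (rule bij_betw_imageI)
  show "inj_on (\<lambda>p. edge_at p ` {..<n}) edge_pairings"
    by (rule inj_onI) (auto simp: edge_pairings_def intro: pairing_determined_by_edges)
  show "(\<lambda>p. edge_at p ` {..<n}) ` edge_pairings = perfect_matchings G"
    using perfect_matching_edge_at by (auto elim!: perfect_matching_obtains_pairing)
qed

text \<open>In the product over inversions, comparisons inside a block are 1 because each pair is
  listed in increasing order, and the four comparisons between two blocks form the crossing sign of
  their edges.\<close>

lemma sign_edge_pairing:
  assumes "p \<in> edge_pairings"
  shows "sign p = matching_sign (edge_at p ` {..<n})"
proof -
  let ?M = "edge_at p ` {..<n}"
  have p: "p \<in> pairings n"
    using assms by (simp add: edge_pairings_def)
  have M: "matching ?M"
    using perfect_matching_edge_at[OF assms] by (rule perfect_matching_imp_matching)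
  have cross_eq: "cross (edge_at p i) (edge_at p j) =
      cmp (p (2 * i)) (p (2 * j)) * cmp (p (2 * i)) (p (2 * j + 1)) *
      (cmp (p (2 * i + 1)) (p (2 * j)) * cmp (p (2 * i + 1)) (p (2 * j + 1)))"
    if "i < n" "j < n" for i j
  proof -
    have "vs ! p (2 * k) \<noteq> vs ! p (2 * k + 1)" if "k < n" for k
      using that pairingsD(2)[OF p, of "2 * k"] pairingsD(2)[OF p, of "2 * k + 1"]
        pairingsD(3)[OF p, of k] by (subst nth_eq_iff) auto
    with that show ?thesis
      using pairingsD(2)[OF p] by (simp add: cross_def edge_at_def)
  qed
  have "sign p = (\<Prod>v<2 * n. \<Prod>u<v. cmp (p u) (p v))"
    using sign_eq_inv_sign[OF pairingsD(1)[OF p]]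
    by (simp only: inv_sign_def prod_increasing_pairs_lessThan)
  also have "\<dots> = (\<Prod>j<n. cmp (p (2 * j)) (p (2 * j + 1))) *
      (\<Prod>j<n. \<Prod>i<j. cross (edge_at p i) (edge_at p j))"
    unfolding prod_pairs_double by (intro arg_cong2[where f = "(*)"] prod.cong refl) (auto simp: cross_eq)
  also have "(\<Prod>j<n. cmp (p (2 * j)) (p (2 * j + 1))) = 1"
    using pairingsD(3)[OF p] by (intro prod.neutral) (auto simp: cmp_def)
  also have "(\<Prod>j<n. \<Prod>i<j. cross (edge_at p i) (edge_at p j)) =
      (\<Prod>(i, j)\<in>increasing_pairs id {..<n}. cross (edge_at p i) (edge_at p j))"
    by (rule prod_increasing_pairs_lessThan[symmetric])
  also have "\<dots> = matching_sign ?M"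
    unfolding matching_sign_def
  proof (rule prod_increasing_pairs_reindex)
    show "bij_betw (edge_at p) {..<n} ?M"
      using inj_on_edge_at[OF p] by (simp add: bij_betw_def)
    show "inj_on lo ?M"
      using M by (rule inj_on_lo)
    show "cross e f = cross f e" if "e \<in> ?M" "f \<in> ?M" "e \<noteq> f" for e f
      using cross_commute_matching[OF M] that by blast
  qed simp
  finally show ?thesis by simp
qed

text \<open>A pairing that uses a non-edge has a zero factor; the remaining pairings correspond to
  the perfect matchings.\<close>

lemma pfaffian_skew_adjacency:
  assumes D: "is_orientation G D"
  shows "pfaffian (skew_adjacency vs D) = (\<Sum>M\<in>perfect_matchings G.
    Poly_Mapping.single (edge_monomial M) (real_of_int (pfaffian_sign D M)))"
proof -
  let ?A = "skew_adjacency vs D"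
  have dim: "dim_row ?A = 2 * n"
    by (simp add: skew_adjacency_def length_vs)
  \<comment> \<open>Since \<open>p (2 * i) < p (2 * i + 1)\<close>, only entries above the diagonal
    occur, and their signs are the arc signs.\<close>
  have entry: "?A $$ (p (2 * i), p (2 * i + 1)) =
      (if edge_at p i \<in> edges G then of_int (arc_sign D (edge_at p i)) * indet (edge_at p i) else 0)"
    if p: "p \<in> pairings n" and "i < n" for p i
  proof -
    let ?u = "vs ! p (2 * i)" and ?v = "vs ! p (2 * i + 1)"
    have "p (2 * i) < 2 * n" "p (2 * i + 1) < 2 * n"
      using pairingsD(2)[OF p] \<open>i < n\<close> by auto
    then have "?A $$ (p (2 * i), p (2 * i + 1)) = (if (?u, ?v) \<in> D then indet {?u, ?v}
        else if (?v, ?u) \<in> D then - indet {?u, ?v} else 0)"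
      by (simp add: skew_adjacency_def length_vs)
    moreover have "arc_sign D (edge_at p i) = (if (?u, ?v) \<in> D then 1 else - 1)"
      using lo_hi_edge_at[OF p \<open>i < n\<close>] by (simp add: arc_sign_def)
    moreover have "{?u, ?v} \<in> edges G \<longleftrightarrow> (?u, ?v) \<in> D \<or> (?v, ?u) \<in> D"
    proof
      show "(?u, ?v) \<in> D \<or> (?v, ?u) \<in> D" if "{?u, ?v} \<in> edges G"
        using D that unfolding is_orientation_def by blast
      have arc: "{u, v} \<in> edges G" if "(u, v) \<in> D" for u v
        using D that unfolding is_orientation_def by blast
      show "{?u, ?v} \<in> edges G" if "(?u, ?v) \<in> D \<or> (?v, ?u) \<in> D"
        using that
      proof
        assume "(?v, ?u) \<in> D"
        from arc[OF this] show ?thesis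
          by (subst insert_commute)
      qed (rule arc)
    qed
    ultimately show ?thesis
      by (simp add: edge_at_def)
  qed
  have "pfaffian ?A = (\<Sum>p\<in>pairings n. of_int (sign p) *
      (\<Prod>i<n. ?A $$ (p (2 * i), p (2 * i + 1))))"
    by (simp add: pfaffian_def dim)
  also have "\<dots> = (\<Sum>p\<in>edge_pairings. of_int (sign p) *
      (\<Prod>i<n. ?A $$ (p (2 * i), p (2 * i + 1))))"
  proof (rule sum.mono_neutral_right)
    show "finite (pairings n)"
      by (rule finite_subset[OF _ finite_permutations[of "{..<2 * n}"]]) (auto simp: pairings_def)
    show "\<forall>p\<in>pairings n - edge_pairings. of_int (sign p) *
        (\<Prod>i<n. ?A $$ (p (2 * i), p (2 * i + 1))) = 0"
    proof
      fix p assume "p \<in> pairings n - edge_pairings"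
      then obtain i where "p \<in> pairings n" "i < n" "edge_at p i \<notin> edges G"
        by (auto simp: edge_pairings_def)
      then have "\<exists>i\<in>{..<n}. ?A $$ (p (2 * i), p (2 * i + 1)) = 0"
        using entry by auto
      then have "(\<Prod>i<n. ?A $$ (p (2 * i), p (2 * i + 1))) = 0"
        by (intro prod_zero) auto
      then show "of_int (sign p) * (\<Prod>i<n. ?A $$ (p (2 * i), p (2 * i + 1))) = 0"
        by simp
    qed
  qed (auto simp: edge_pairings_def)
  also have "\<dots> = (\<Sum>p\<in>edge_pairings.
      Poly_Mapping.single (edge_monomial (edge_at p ` {..<n}))
        (real_of_int (pfaffian_sign D (edge_at p ` {..<n}))))"
  proof (rule sum.cong)
    fix p assume p': "p \<in> edge_pairings"
    let ?M = "edge_at p ` {..<n}"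
    have p: "p \<in> pairings n" and e: "\<And>i. i < n \<Longrightarrow> edge_at p i \<in> edges G"
      using p' by (auto simp: edge_pairings_def)
    have "(\<Prod>i<n. ?A $$ (p (2 * i), p (2 * i + 1))) =
        (\<Prod>i<n. of_int (arc_sign D (edge_at p i)) * indet (edge_at p i))"
      using entry[OF p] e by (intro prod.cong) auto
    also have "\<dots> = (\<Prod>e\<in>?M. of_int (arc_sign D e) * indet e)"
      using inj_on_edge_at[OF p] by (simp add: prod.reindex)
    also have "\<dots> = of_int (\<Prod>e\<in>?M. arc_sign D e) * Poly_Mapping.single (edge_monomial ?M) 1"
      by (simp add: prod.distrib prod_indet)
    finally have "of_int (sign p) * (\<Prod>i<n. ?A $$ (p (2 * i), p (2 * i + 1))) =
        of_int (pfaffian_sign D ?M) * Poly_Mapping.single (edge_monomial ?M) 1"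
      by (simp add: sign_edge_pairing[OF p'] pfaffian_sign_def mult.assoc)
    also have "\<dots> = Poly_Mapping.single (edge_monomial ?M) (real_of_int (pfaffian_sign D ?M))"
      by (simp add: mult_single flip: single_of_int)
    finally show "of_int (sign p) * (\<Prod>i<n. ?A $$ (p (2 * i), p (2 * i + 1))) =
        Poly_Mapping.single (edge_monomial ?M) (real_of_int (pfaffian_sign D ?M))" .
  qed simp
  also have "\<dots> = (\<Sum>M\<in>perfect_matchings G.
      Poly_Mapping.single (edge_monomial M) (real_of_int (pfaffian_sign D M)))"
    by (rule sum.reindex_bij_betw[OF bij_betw_edge_pairings])
  finally show ?thesis .
qed

text \<open>Comparing coefficients turns the polynomial identity into one linear equation for each
  perfect matching.\<close>

lemma k_pfaffian_iff:
  "k_pfaffian G vs k \<longleftrightarrow> (\<exists>D c. (\<forall>i<k. is_orientation G (D i)) \<and>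
     (\<forall>M\<in>perfect_matchings G. (\<Sum>i<k. c i * real_of_int (pfaffian_sign (D i) M)) = 1))"
proof -
  have "PM G = (\<Sum>i<k. const_poly (c i) * pfaffian (skew_adjacency vs (D i))) \<longleftrightarrow>
      (\<forall>M\<in>perfect_matchings G. (\<Sum>i<k. c i * real_of_int (pfaffian_sign (D i) M)) = 1)"
    if D: "\<forall>i<k. is_orientation G (D i)" for D c
  proof -
    have "(\<Sum>i<k. const_poly (c i) * pfaffian (skew_adjacency vs (D i))) =
        (\<Sum>i<k. \<Sum>M\<in>perfect_matchings G. Poly_Mapping.single (edge_monomial M)
          (c i * real_of_int (pfaffian_sign (D i) M)))"
      using D by (intro sum.cong)
        (simp_all add: pfaffian_skew_adjacency const_poly_def sum_distrib_left mult_single)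
    also have "\<dots> = (\<Sum>M\<in>perfect_matchings G. \<Sum>i<k. Poly_Mapping.single (edge_monomial M)
          (c i * real_of_int (pfaffian_sign (D i) M)))"
      by (rule sum.swap)
    also have "\<dots> = (\<Sum>M\<in>perfect_matchings G. Poly_Mapping.single (edge_monomial M)
          (\<Sum>i<k. c i * real_of_int (pfaffian_sign (D i) M)))"
      by (intro sum.cong refl poly_mapping_eqI) (simp add: lookup_sum lookup_single when_def)
    finally have "PM G = (\<Sum>i<k. const_poly (c i) * pfaffian (skew_adjacency vs (D i))) \<longleftrightarrow>
        (\<Sum>M\<in>perfect_matchings G. Poly_Mapping.single (edge_monomial M) 1) =
        (\<Sum>M\<in>perfect_matchings G. Poly_Mapping.single (edge_monomial M)
          (\<Sum>i<k. c i * real_of_int (pfaffian_sign (D i) M)))"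
      by (simp add: PM_def prod_indet)
    also have "\<dots> \<longleftrightarrow>
        (\<forall>M\<in>perfect_matchings G. 1 = (\<Sum>i<k. c i * real_of_int (pfaffian_sign (D i) M)))"
      by (intro sum_single_edge_monomial_eq_iff finite_perfect_matchings)
         (auto dest: perfect_matching_imp_matching finite_matching)
    also have "\<dots> \<longleftrightarrow>
        (\<forall>M\<in>perfect_matchings G. (\<Sum>i<k. c i * real_of_int (pfaffian_sign (D i) M)) = 1)"
      by (intro ball_cong refl eq_commute)
    finally show ?thesis .
  qed
  then show ?thesis
    unfolding k_pfaffian_def by (intro ex_cong1 conj_cong refl) blast
qed

subsection \<open>Every graph is \<open>k\<close>-Pfaffian for some \<open>k\<close>\<close>

text \<open>\<open>W\<close> collects the edges directed from the higher to the lower position, so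
  that sets of edges parametrize orientations.\<close>

definition orientation_of :: "'a set set \<Rightarrow> ('a \<times> 'a) set" where
  "orientation_of W = {(u, v). {u, v} \<in> edges G \<and> (pos u < pos v \<longleftrightarrow> {u, v} \<notin> W)}"

lemma is_orientation_orientation_of: "is_orientation G (orientation_of W)"
proof -
  have "pos u \<noteq> pos v" if "{u, v} \<in> edges G" for u v
    using that card_edge[OF that] edge_subset[OF that]
    by (subst pos_eq_iff) auto
  then show ?thesis
    by (fastforce simp: is_orientation_def orientation_of_def insert_commute)
qed

lemma arc_sign_orientation_of:
  assumes "e \<in> edges G"
  shows "arc_sign (orientation_of W) e = neg_on W e"
proof -
  have "pos (vs ! lo e) < pos (vs ! hi e)"
    using assms lo_less_hi lo_less hi_less by simp
  moreover have "{vs ! lo e, vs ! hi e} = e"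
    using edge_eq[OF assms] by simp
  ultimately show ?thesis
    using assms by (simp add: arc_sign_def orientation_of_def neg_on_def)
qed

end

section \<open>Characters of the group of edge sets\<close>

lemma neg_on_square: "neg_on N x * neg_on N x = 1"
  by (simp add: neg_on_def)

text \<open>This is the factor by which the character of \<open>M\<close> changes when the single
  edge \<open>a\<close> is reversed.\<close>

lemma prod_neg_on_singleton:
  assumes "finite M"
  shows "(\<Prod>x\<in>M. neg_on {a} x) = neg_on M a"
  using assms by (simp add: neg_on_def prod.If_cases)

text \<open>For \<open>M = N\<close> every summand is 1. Otherwise toggling an element
  \<open>a\<close> of exactly one of the two sets is an involution of \<open>Pow E\<close> that
  negates the summand.\<close>

lemma neg_on_characters_orthogonal:
  assumes "finite E" "M \<subseteq> E" "N \<subseteq> E"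
  shows "(\<Sum>W\<in>Pow E. (\<Prod>e\<in>M. neg_on W e) * (\<Prod>e\<in>N. neg_on W e)) =
    (if M = N then 2 ^ card E else 0)"
proof (cases "M = N")
  case True
  have "(\<Prod>e\<in>M. neg_on W e) * (\<Prod>e\<in>N. neg_on W e) = 1" for W
    by (simp add: True neg_on_square flip: prod.distrib)
  then show ?thesis
    using assms True by (simp add: card_Pow)
next
  case False
  then obtain a where a: "a \<in> sym_diff M N" by blast
  have fin: "finite M" "finite N"
    using assms finite_subset by auto
  let ?f = "\<lambda>W. (\<Prod>e\<in>M. neg_on W e) * (\<Prod>e\<in>N. neg_on W e)"
  have flip: "?f (sym_diff W {a}) = - ?f W" for W
  proof -
    have "?f (sym_diff W {a}) = ?f W * (neg_on M a * neg_on N a)"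
      by (simp only: neg_on_sym_diff prod.distrib prod_neg_on_singleton[OF fin(1)]
          prod_neg_on_singleton[OF fin(2)] mult_ac)
    also have "neg_on M a * neg_on N a = - 1"
      using a by (auto simp: neg_on_def)
    finally show ?thesis by simp
  qed
  have invol: "sym_diff (sym_diff W {a}) {a} = W" for W
    by auto
  have "(\<Sum>W\<in>Pow E. ?f W) = (\<Sum>W\<in>Pow E. ?f (sym_diff W {a}))"
    by (rule sum.reindex_bij_witness[of _ "\<lambda>W. sym_diff W {a}" "\<lambda>W. sym_diff W {a}"])
       (use a assms in \<open>auto simp: invol\<close>)
  also have "\<dots> = - (\<Sum>W\<in>Pow E. ?f W)"
    unfolding flip by (rule sum_negf)
  finally show ?thesis
    using False by simp
qed

context ordered_graph
begin

lemma ex_k_pfaffian: "\<exists>k>0. k_pfaffian G vs k"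
proof -
  let ?E = "edges G"
  let ?P = "perfect_matchings G"
  let ?\<chi> = "\<lambda>W M. \<Prod>e\<in>M. neg_on W e"
  define k where "k = card (Pow ?E)"
  obtain w where w: "bij_betw w {..<k} (Pow ?E)"
    using ex_bij_betw_nat_finite[of "Pow ?E"] finite_edges
    by (auto simp: k_def lessThan_atLeast0)
  \<comment> \<open>These are the Fourier coefficients of the matching signs; Fourier inversion
    recovers \<open>matching_sign M\<close>, which cancels the one in
    \<open>pfaffian_sign\<close>.\<close>
  define c where "c W = real_of_int (\<Sum>N\<in>?P. matching_sign N * ?\<chi> W N) / 2 ^ card ?E" for W
  have sign: "pfaffian_sign (orientation_of W) M = matching_sign M * ?\<chi> W M" if "M \<in> ?P" for W M
    using that unfolding pfaffian_sign_def
    by (intro arg_cong2[where f = "(*)"] prod.cong refl arc_sign_orientation_of)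
       (auto simp: perfect_matchings_def)
  have "(\<Sum>i<k. c (w i) * real_of_int (pfaffian_sign (orientation_of (w i)) M)) = 1"
    if M: "M \<in> ?P" for M
  proof -
    have sub: "N \<subseteq> ?E" if "N \<in> ?P" for N
      using that by (auto simp: perfect_matchings_def)
    have "(\<Sum>i<k. c (w i) * real_of_int (pfaffian_sign (orientation_of (w i)) M)) =
        (\<Sum>W\<in>Pow ?E. c W * real_of_int (pfaffian_sign (orientation_of W) M))"
      by (rule sum.reindex_bij_betw[OF w])
    also have "\<dots> = real_of_int (\<Sum>W\<in>Pow ?E. \<Sum>N\<in>?P.
        matching_sign N * matching_sign M * (?\<chi> W N * ?\<chi> W M)) / 2 ^ card ?E"
      by (simp add: c_def sign[OF M] sum_distrib_left sum_distrib_right sum_divide_distrib mult_ac)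
    also have "(\<Sum>W\<in>Pow ?E. \<Sum>N\<in>?P. matching_sign N * matching_sign M * (?\<chi> W N * ?\<chi> W M)) =
        (\<Sum>N\<in>?P. \<Sum>W\<in>Pow ?E. matching_sign N * matching_sign M * (?\<chi> W N * ?\<chi> W M))"
      by (rule sum.swap)
    also have "\<dots> = (\<Sum>N\<in>?P. if N = M then 2 ^ card ?E else 0)"
      using neg_on_characters_orthogonal[OF finite_edges sub sub[OF M]]
      by (intro sum.cong refl) (simp add: matching_sign_square flip: sum_distrib_left)
    also have "\<dots> = 2 ^ card ?E"
      using M finite_perfect_matchings by simp
    finally show ?thesis by simp
  qed
  then have "k_pfaffian G vs k"
    unfolding k_pfaffian_iff using is_orientation_orientation_of
    by (intro exI[of _ "\<lambda>i. orientation_of (w i)"] exI[of _ "\<lambda>i. c (w i)"]) auto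
  moreover have "k > 0"
    using finite_edges by (simp add: k_def card_Pow)
  ultimately show ?thesis by blast
qed

subsection \<open>Multiplicativity over disjoint unions\<close>

text \<open>Pairs within \<open>M\<close> and within \<open>N\<close> give the two signs. The mixed
  pairs give \<open>cross e f\<close> once for each \<open>(e, f)\<close> in
  \<open>M \<times> N\<close>, and the product of all these depends only on the vertices covered by
  \<open>M\<close> and \<open>N\<close>.\<close>

lemma matching_sign_union:
  assumes MN: "matching (M \<union> N)" and disj: "M \<inter> N = {}"
  shows "matching_sign (M \<union> N) = matching_sign M * matching_sign N *
    (\<Prod>u\<in>\<Union>M. \<Prod>v\<in>\<Union>N. cmp (pos u) (pos v))"
proof -
  let ?h = "\<lambda>(e, f). cross e f"
  let ?A = "{(e, f) \<in> M \<times> N. lo e < lo f}" and ?B = "{(f, e) \<in> N \<times> M. lo f < lo e}"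
  have M: "matching M" "finite M" and N: "matching N" "finite N"
    using MN finite_matching by (auto intro: matching_subset)
  have fin: "finite ?A" "finite ?B"
    by (rule finite_subset[of _ "M \<times> N"] finite_subset[of _ "N \<times> M"]; use M(2) N(2) in auto)+
  have disj_pairs: "increasing_pairs lo M \<inter> increasing_pairs lo N = {}"
    "(increasing_pairs lo M \<union> increasing_pairs lo N) \<inter> (?A \<union> ?B) = {}"
    using disj by (auto simp: increasing_pairs_def)
  have "increasing_pairs lo (M \<union> N) = (increasing_pairs lo M \<union> increasing_pairs lo N) \<union> (?A \<union> ?B)"
    by (auto simp: increasing_pairs_def)
  then have "matching_sign (M \<union> N) = prod ?h (increasing_pairs lo M \<union> increasing_pairs lo N) *
      prod ?h (?A \<union> ?B)"
    unfolding matching_sign_def using M N fin disj_pairs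
    by (simp only:) (rule prod.union_disjoint, simp_all)
  also have "prod ?h (increasing_pairs lo M \<union> increasing_pairs lo N) =
      matching_sign M * matching_sign N"
    unfolding matching_sign_def using M N disj_pairs
    by (intro prod.union_disjoint) simp_all
  also have "prod ?h (?A \<union> ?B) = prod ?h ?A * prod ?h ?B"
    using fin disj by (intro prod.union_disjoint) auto
  \<comment> \<open>Lower ends of distinct edges differ, so swapping maps \<open>?B\<close> onto the
    mixed pairs missing from \<open>?A\<close>; symmetry of \<open>cross\<close> preserves the
    factors.\<close>
  also have "prod ?h ?B = prod ?h (M \<times> N - ?A)"
  proof (rule prod.reindex_bij_witness[of _ prod.swap prod.swap])
    fix x assume "x \<in> M \<times> N - ?A"
    then obtain e f where x: "x = (e, f)" "e \<in> M" "f \<in> N" "\<not> lo e < lo f" by auto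
    moreover have "lo e \<noteq> lo f"
      using x disj inj_onD[OF inj_on_lo[OF MN], of e f] by auto
    ultimately show "prod.swap x \<in> ?B" by auto
  next
    fix x assume "x \<in> ?B"
    then obtain f e where x: "x = (f, e)" "f \<in> N" "e \<in> M" by auto
    moreover have "f \<noteq> e"
      using x disj by auto
    ultimately show "?h (prod.swap x) = ?h x"
      using cross_commute_matching[OF MN, of e f] by simp
  qed auto
  also have "prod ?h ?A * prod ?h (M \<times> N - ?A) = prod ?h (M \<times> N)"
    using M N by (subst mult.commute, intro prod.subset_diff[symmetric]) auto
  also have "\<dots> = (\<Prod>e\<in>M. \<Prod>f\<in>N. \<Prod>u\<in>e. \<Prod>v\<in>f. cmp (pos u) (pos v))"
    by (simp add: prod.cartesian_product cross_def)
  \<comment> \<open>Once each vertex product stands next to its edge product, disjointness merges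
    the two into a product over covered vertices.\<close>
  also have "\<dots> = (\<Prod>e\<in>M. \<Prod>u\<in>e. \<Prod>f\<in>N. \<Prod>v\<in>f. cmp (pos u) (pos v))"
    by (intro prod.cong refl prod.swap)
  also have "\<dots> = (\<Prod>u\<in>\<Union>M. \<Prod>v\<in>\<Union>N. cmp (pos u) (pos v))"
    using M(1) N(1) finite_edge by (subst (1 2) prod.Union_disjoint) (auto simp: matching_def)
  finally show ?thesis .
qed

lemma pfaffian_sign_union:
  assumes "matching (M \<union> N)" "M \<inter> N = {}"
  shows "pfaffian_sign D (M \<union> N) = pfaffian_sign D M * pfaffian_sign D N *
    (\<Prod>u\<in>\<Union>M. \<Prod>v\<in>\<Union>N. cmp (pos u) (pos v))"
  using finite_matching[OF assms(1)] assms(2)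
  by (simp add: pfaffian_sign_def matching_sign_union[OF assms] prod.union_disjoint mult_ac)

lemma pfaffian_sign_empty [simp]: "pfaffian_sign D {} = 1"
  by (simp add: pfaffian_sign_def matching_sign_def increasing_pairs_def)

lemma pfaffian_sign_singleton [simp]: "pfaffian_sign D {e} = arc_sign D e"
proof -
  have "increasing_pairs lo {e} = {}"
    by (auto simp: increasing_pairs_def)
  then show ?thesis
    by (simp add: pfaffian_sign_def matching_sign_def)
qed

lemma pfaffian_sign_insert:
  assumes "matching (insert e N)" "e \<notin> N"
  shows "pfaffian_sign D (insert e N) = arc_sign D e * pfaffian_sign D N *
    (\<Prod>u\<in>e. \<Prod>v\<in>\<Union>N. cmp (pos u) (pos v))"
  using pfaffian_sign_union[of "{e}" N D] assms by simp

lemma arc_sign_square: "arc_sign D e * arc_sign D e = 1"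
  by (simp add: arc_sign_def)

lemma pfaffian_sign_square: "pfaffian_sign D M * pfaffian_sign D M = 1"
proof -
  have "(\<Prod>e\<in>M. arc_sign D e) * (\<Prod>e\<in>M. arc_sign D e) = 1"
    by (simp add: arc_sign_square flip: prod.distrib)
  then show ?thesis
    using matching_sign_square[of M] by (simp add: pfaffian_sign_def mult_ac)
qed

end

section \<open>Disjoint copies of \<open>K\<^sub>3\<^sub>,\<^sub>3\<close>\<close>

text \<open>The triple \<open>(x, y, z)\<close> stands for the perfect matching joining the vertices \<open>0, 1, 2\<close>
  on the left to \<open>x, y, z\<close> on the right.\<close>

definition triples :: "(nat \<times> nat \<times> nat) set" where
  "triples = {(0, 1, 2), (0, 2, 1), (1, 0, 2), (1, 2, 0), (2, 0, 1), (2, 1, 0)}"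

lemma card_triples: "card triples = 6"
  by (simp add: triples_def)

lemma finite_triples [simp]: "finite triples"
  by (simp add: triples_def)

definition copy_matching :: "nat \<Rightarrow> nat \<times> nat \<times> nat \<Rightarrow> (nat \<times> (nat + nat)) set set" where
  "copy_matching c t = (case t of (x, y, z) \<Rightarrow>
     {{(c, Inl 0), (c, Inr x)}, {(c, Inl 1), (c, Inr y)}, {(c, Inl 2), (c, Inr z)}})"

text \<open>The choice functions \<open>\<pi>\<close> index the coordinates of an
  \<open>r\<close>-fold tensor.\<close>

definition copies_matching :: "nat \<Rightarrow> (nat \<Rightarrow> nat \<times> nat \<times> nat) \<Rightarrow> (nat \<times> (nat + nat)) set set" where
  "copies_matching r \<pi> = (\<Union>c<r. copy_matching c (\<pi> c))"

lemma lessThan_3: "{..<3::nat} = {0, 1, 2}"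
  by auto

lemma vertices_copies:
  "vertices (disjoint_copies r (complete_bipartite 3 3)) =
   {..<r} \<times> {Inl 0, Inl 1, Inl 2, Inr 0, Inr 1, Inr 2}"
  by (auto simp: disjoint_copies_def complete_bipartite_def lessThan_3)

lemma edges_copies:
  "edges (disjoint_copies r (complete_bipartite 3 3)) =
   {{(c, Inl i), (c, Inr j)} | c i j. c < r \<and> i < 3 \<and> j < 3}"
proof -
  have "edges (disjoint_copies r (complete_bipartite 3 3)) =
      {Pair c ` {Inl i, Inr j} | c i j. c < r \<and> i < 3 \<and> j < 3}"
    unfolding disjoint_copies_def complete_bipartite_def snd_conv by blast
  then show ?thesis by simp
qed

lemma triplesD:
  assumes "(x, y, z) \<in> triples"
  shows "{x, y, z} = {0, 1, 2}" "x \<noteq> y" "x \<noteq> z" "y \<noteq> z"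
  using assms by (auto simp: triples_def)

lemma Union_copy_matching:
  assumes "t \<in> triples"
  shows "\<Union>(copy_matching c t) = {c} \<times> {Inl 0, Inl 1, Inl 2, Inr 0, Inr 1, Inr 2}"
proof -
  obtain x y z where t: "t = (x, y, z)" by (cases t)
  have "\<Union>(copy_matching c t) = Pair c ` ({Inl 0, Inl 1, Inl 2} \<union> Inr ` {x, y, z})"
    unfolding t copy_matching_def by auto
  also have "{x, y, z} = {0, 1, 2}"
    using assms unfolding t by (rule triplesD)
  finally show ?thesis by auto
qed

lemma copy_matching_disjoint:
  assumes "t \<in> triples" "e \<in> copy_matching c t" "f \<in> copy_matching c t" "v \<in> e" "v \<in> f"
  shows "e = f"
proof -
  obtain x y z where t: "t = (x, y, z)" by (cases t)
  show ?thesis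
    using triplesD(2-4)[of x y z] assms unfolding t copy_matching_def by auto
qed

lemma fst_copy_matching: "e \<in> copy_matching c t \<Longrightarrow> v \<in> e \<Longrightarrow> fst v = c"
  by (cases t) (auto simp: copy_matching_def)

lemma ex1_copy_matching:
  assumes "t \<in> triples" "x \<in> {Inl 0, Inl 1, Inl 2, Inr 0, Inr 1, Inr 2}"
  shows "\<exists>!e. e \<in> copy_matching c t \<and> (c, x) \<in> e"
proof -
  have "(c, x) \<in> \<Union>(copy_matching c t)"
    unfolding Union_copy_matching[OF assms(1)] using assms(2) by blast
  then show ?thesis
    using copy_matching_disjoint[OF assms(1)] by blast
qed

lemma copy_matching_subset_edges:
  assumes "t \<in> triples" "c < r"
  shows "copy_matching c t \<subseteq> edges (disjoint_copies r (complete_bipartite 3 3))"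
proof -
  obtain x y z where t: "t = (x, y, z)" by (cases t)
  have "{(c, Inl i), (c, Inr j)} \<in> edges (disjoint_copies r (complete_bipartite 3 3))"
    if "i < 3" "j < 3" for i j
    unfolding edges_copies using that assms(2) by blast
  moreover have "x < 3" "y < 3" "z < 3"
    using assms(1) by (auto simp: t triples_def)
  ultimately show ?thesis
    unfolding t copy_matching_def by simp
qed

lemma perfect_matching_copies_matching:
  assumes "\<And>c. c < r \<Longrightarrow> \<pi> c \<in> triples"
  shows "copies_matching r \<pi> \<in> perfect_matchings (disjoint_copies r (complete_bipartite 3 3))"
proof -
  let ?V = "{Inl 0, Inl 1, Inl 2, Inr 0, Inr 1, Inr 2} :: (nat + nat) set"
  have "\<exists>!e. e \<in> copies_matching r \<pi> \<and> (c, x) \<in> e" if "c < r" "x \<in> ?V" for c x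
  proof -
    \<comment> \<open>The first component of a vertex fixes the copy, so uniqueness reduces to a
      single copy.\<close>
    have "e \<in> copies_matching r \<pi> \<and> (c, x) \<in> e \<longleftrightarrow> e \<in> copy_matching c (\<pi> c) \<and> (c, x) \<in> e" for e
    proof -
      have "d = c" if "e \<in> copy_matching d (\<pi> d)" "(c, x) \<in> e" for d
        using fst_copy_matching[OF that] by simp
      with \<open>c < r\<close> show ?thesis
        unfolding copies_matching_def by blast
    qed
    then show ?thesis
      using ex1_copy_matching[OF assms[OF that(1)] that(2)] by simp
  qed
  moreover have "copies_matching r \<pi> \<subseteq> edges (disjoint_copies r (complete_bipartite 3 3))"
    unfolding copies_matching_def using copy_matching_subset_edges[OF assms] by blast
  ultimately show ?thesis
    unfolding perfect_matchings_def vertices_copies by blast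
qed

text \<open>Every pair of disjoint edges of \<open>K\<^sub>3\<^sub>,\<^sub>3\<close> lies in exactly one perfect
  matching. In the product every factor therefore cancels, up to sign, against another one, and the
  remaining sign says that \<open>K\<^sub>3\<^sub>,\<^sub>3\<close> has an odd number of crossings in every drawing.\<close>

lemma prod_triples_eq_minus_one:
  fixes a :: "nat \<Rightarrow> nat \<Rightarrow> int" and s :: "nat + nat \<Rightarrow> nat + nat \<Rightarrow> int"
  assumes a: "\<And>i j. a i j * a i j = 1" and s: "\<And>u v. s u v * s u v = 1"
    and swap: "\<And>u v. u \<in> V \<Longrightarrow> v \<in> V \<Longrightarrow> u \<noteq> v \<Longrightarrow> s v u = - s u v"
    and V: "V = {Inl 0, Inl 1, Inl 2, Inr 0, Inr 1, Inr 2}"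
  shows "(\<Prod>(x, y, z)\<in>triples. a 0 x * (a 1 y * a 2 z *
      (s (Inl 1) (Inl 2) * s (Inl 1) (Inr z) * (s (Inr y) (Inl 2) * s (Inr y) (Inr z)))) *
      (s (Inl 0) (Inl 1) * s (Inl 0) (Inr y) * (s (Inr x) (Inl 1) * s (Inr x) (Inr y)) *
      (s (Inl 0) (Inl 2) * s (Inl 0) (Inr z) * (s (Inr x) (Inl 2) * s (Inr x) (Inr z))))) = - 1"
proof -
  \<comment> \<open>\<open>rl\<close> and \<open>rr\<close> bring every comparison into a standard
    order, left before right and then smaller index first, so that equal factors cancel as
    squares.\<close>
  have rl: "s (Inr j) (Inl i) = - s (Inl i) (Inr j)" if "i \<in> {0, 1, 2}" "j \<in> {0, 1, 2}" for i j
    using that by (intro swap) (auto simp: V)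
  have rr: "s (Inr 1) (Inr 0) = - s (Inr 0) (Inr 1)" "s (Inr 2) (Inr 0) = - s (Inr 0) (Inr 2)"
    "s (Inr 2) (Inr 1) = - s (Inr 1) (Inr 2)"
    by (intro swap; simp add: V)+
  have left: "a i j * (a i j * k) = k" "s u v * (s u v * k) = k" for i j u v k
    using a[of i j] s[of u v] by (simp_all flip: mult.assoc)
  show ?thesis
    by (simp add: triples_def rl rr del: One_nat_def) (simp add: a s left mult_ac del: One_nat_def)
qed

section \<open>Signs of matchings in the disjoint copies\<close>

locale k33_copies = ordered_graph "disjoint_copies r (complete_bipartite 3 3)" vs "3 * r"
  for r :: nat and vs :: "(nat \<times> (nat + nat)) list"
begin

text \<open>Peeling off two of the three edges expresses each sign through arc signs and
  comparisons, in the shape of \<open>prod_triples_eq_minus_one\<close>.\<close>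

lemma prod_pfaffian_sign_copy_matching:
  assumes "c < r"
  shows "(\<Prod>t\<in>triples. pfaffian_sign D (copy_matching c t)) = - 1"
proof -
  let ?V = "{Inl 0, Inl 1, Inl 2, Inr 0, Inr 1, Inr 2} :: (nat + nat) set"
  let ?a = "\<lambda>i j. arc_sign D {(c, Inl i), (c, Inr j)}"
  let ?s = "\<lambda>u v. cmp (pos (c, u)) (pos (c, v))"
  have "pfaffian_sign D (copy_matching c t) = (case t of (x, y, z) \<Rightarrow> ?a 0 x * (?a 1 y * ?a 2 z *
      (?s (Inl 1) (Inl 2) * ?s (Inl 1) (Inr z) * (?s (Inr y) (Inl 2) * ?s (Inr y) (Inr z)))) *
      (?s (Inl 0) (Inl 1) * ?s (Inl 0) (Inr y) * (?s (Inr x) (Inl 1) * ?s (Inr x) (Inr y)) *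
      (?s (Inl 0) (Inl 2) * ?s (Inl 0) (Inr z) * (?s (Inr x) (Inl 2) * ?s (Inr x) (Inr z)))))"
    if t: "t \<in> triples" for t
  proof -
    obtain x y z where xyz: "t = (x, y, z)" by (cases t)
    have ne: "x \<noteq> y" "x \<noteq> z" "y \<noteq> z"
      using t by (auto simp: triples_def xyz)
    \<comment> \<open>Taking \<open>t\<close> in every copy extends \<open>copy_matching c t\<close>
      to a perfect matching, which shows that it is a matching.\<close>
    define \<pi> where "\<pi> = (\<lambda>_ :: nat. t)"
    have m: "matching (copies_matching r \<pi>)"
      using t by (intro perfect_matching_imp_matching perfect_matching_copies_matching) (simp add: \<pi>_def)
    have "copy_matching c t \<subseteq> copies_matching r \<pi>"
      using assms by (auto simp: copies_matching_def \<pi>_def)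
    then have 1: "matching {{(c, Inl 0), (c, Inr x)}, {(c, Inl 1), (c, Inr y)}, {(c, Inl 2), (c, Inr z)}}"
      using matching_subset[OF m] by (simp add: copy_matching_def xyz)
    then have 2: "matching {{(c, Inl 1), (c, Inr y)}, {(c, Inl 2), (c, Inr z)}}"
      by (rule matching_subset) auto
    show ?thesis
      using ne 1 2 unfolding xyz copy_matching_def prod.case
      by (subst pfaffian_sign_insert; simp add: doubleton_eq_iff)
         (subst pfaffian_sign_insert; simp add: doubleton_eq_iff mult.assoc[where 'a = int]
           mult.commute[where 'a = int] mult.left_commute[where 'a = int])
  qed
  then have "(\<Prod>t\<in>triples. pfaffian_sign D (copy_matching c t)) = (\<Prod>(x, y, z)\<in>triples. ?a 0 x * (?a 1 y * ?a 2 z *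
      (?s (Inl 1) (Inl 2) * ?s (Inl 1) (Inr z) * (?s (Inr y) (Inl 2) * ?s (Inr y) (Inr z)))) *
      (?s (Inl 0) (Inl 1) * ?s (Inl 0) (Inr y) * (?s (Inr x) (Inl 1) * ?s (Inr x) (Inr y)) *
      (?s (Inl 0) (Inl 2) * ?s (Inl 0) (Inr z) * (?s (Inr x) (Inl 2) * ?s (Inr x) (Inr z)))))"
    by (intro prod.cong) auto
  also have "\<dots> = - 1"
  proof (rule prod_triples_eq_minus_one[OF _ _ _ refl])
    show "?s v u = - ?s u v" if "u \<in> ?V" "v \<in> ?V" "u \<noteq> v" for u v
      using that assms
      by (intro cmp_swap, subst pos_eq_iff) (auto simp: vertices_copies)
  qed (simp_all add: arc_sign_def)
  finally show ?thesis .
qed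

text \<open>Comparisons between vertices of different copies: the factor left over by the union
  formula, which depends neither on the matchings chosen nor on the orientation.\<close>

definition order_sign :: int where
  "order_sign = (\<Prod>c<r. \<Prod>u\<in>{..<c} \<times> {Inl 0, Inl 1, Inl 2, Inr 0, Inr 1, Inr 2}.
     \<Prod>v\<in>{c} \<times> {Inl 0, Inl 1, Inl 2, Inr 0, Inr 1, Inr 2}. cmp (pos u) (pos v))"

text \<open>Copies are added one at a time. Whatever the chosen matchings, the vertices covered are
  those of entire copies, so the mixed factor is always the same.\<close>

lemma pfaffian_sign_copies_matching:
  assumes \<pi>: "\<And>c. c < r \<Longrightarrow> \<pi> c \<in> triples"
  shows "pfaffian_sign D (copies_matching r \<pi>) =
    order_sign * (\<Prod>c<r. pfaffian_sign D (copy_matching c (\<pi> c)))"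
proof -
  let ?V = "{Inl 0, Inl 1, Inl 2, Inr 0, Inr 1, Inr 2} :: (nat + nat) set"
  have m: "matching (copies_matching r \<pi>)"
    using \<pi> by (intro perfect_matching_imp_matching perfect_matching_copies_matching)
  have "pfaffian_sign D (copies_matching k \<pi>) =
      (\<Prod>c<k. \<Prod>u\<in>{..<c} \<times> ?V. \<Prod>v\<in>{c} \<times> ?V. cmp (pos u) (pos v)) *
      (\<Prod>c<k. pfaffian_sign D (copy_matching c (\<pi> c)))" if "k \<le> r" for k
    using that
  proof (induction k)
    case 0
    show ?case by (simp add: copies_matching_def)
  next
    case (Suc k)
    have eq: "copies_matching (Suc k) \<pi> = copies_matching k \<pi> \<union> copy_matching k (\<pi> k)"
      by (auto simp: copies_matching_def lessThan_Suc)
    have "copies_matching (Suc k) \<pi> \<subseteq> copies_matching r \<pi>"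
      using Suc.prems by (fastforce simp: copies_matching_def)
    then have match: "matching (copies_matching k \<pi> \<union> copy_matching k (\<pi> k))"
      using m matching_subset eq by metis
    have disj: "copies_matching k \<pi> \<inter> copy_matching k (\<pi> k) = {}"
      by (auto simp: copies_matching_def copy_matching_def doubleton_eq_iff split: prod.splits)
    have U1: "\<Union>(copies_matching k \<pi>) = {..<k} \<times> ?V"
    proof -
      have "\<Union>(copies_matching k \<pi>) = (\<Union>c<k. \<Union>(copy_matching c (\<pi> c)))"
        by (auto simp: copies_matching_def)
      also have "\<dots> = (\<Union>c<k. {c} \<times> ?V)"
        using Suc.prems \<pi> by (intro SUP_cong refl Union_copy_matching) auto
      finally show ?thesis by auto
    qed
    have U2: "\<Union>(copy_matching k (\<pi> k)) = {k} \<times> ?V"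
      using Suc.prems \<pi> by (intro Union_copy_matching) auto
    have IH: "pfaffian_sign D (copies_matching k \<pi>) =
      (\<Prod>c<k. \<Prod>u\<in>{..<c} \<times> ?V. \<Prod>v\<in>{c} \<times> ?V. cmp (pos u) (pos v)) *
      (\<Prod>c<k. pfaffian_sign D (copy_matching c (\<pi> c)))"
      using Suc by simp
    show ?case
      unfolding eq pfaffian_sign_union[OF match disj] U1 U2 IH prod.lessThan_Suc
      by (simp only: mult_ac)
  qed
  then show ?thesis
    by (simp add: order_sign_def)
qed

section \<open>Counting the product functionals\<close>

lemma k_pfaffian_lower_bound:
  assumes "k_pfaffian (disjoint_copies r (complete_bipartite 3 3)) vs k"
  shows "(8 / 3 :: real) ^ r \<le> real k"
proof -
  let ?R = "PiE {..<r} (\<lambda>_. triples)"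
  obtain D c where c: "\<And>M. M \<in> perfect_matchings (disjoint_copies r (complete_bipartite 3 3)) \<Longrightarrow>
      (\<Sum>i<k. c i * real_of_int (pfaffian_sign (D i) M)) = 1"
    using assms unfolding k_pfaffian_iff by blast
  define g where "g i d t = pfaffian_sign (D i) (copy_matching d t)" for i d t
  have g_abs: "g i d t \<in> {1, - 1}" for i d t
    using pfaffian_sign_square[of "D i" "copy_matching d t"] unfolding g_def
    by (simp add: zmult_eq_1_iff)
  have g_prod: "(\<Prod>t\<in>triples. g i d t) = - 1" if "d < r" for i d
    unfolding g_def by (rule prod_pfaffian_sign_copy_matching[OF that])
  \<comment> \<open>The functionals that do not vanish on the sign vector of term \<open>i\<close>
    in copy \<open>d\<close>.\<close>
  define Z where "Z i d = {N \<in> even_subsets triples. (\<Sum>t\<in>triples. neg_on N t * g i d t) \<noteq> 0}" for i d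
  have "PiE {..<r} (\<lambda>_. even_subsets triples) \<subseteq> (\<Union>i<k. PiE {..<r} (Z i))"
  proof
    fix \<sigma> assume \<sigma>: "\<sigma> \<in> PiE {..<r} (\<lambda>_. even_subsets triples)"
    let ?w = "\<lambda>\<pi>. \<Prod>d<r. neg_on (\<sigma> d) (\<pi> d)"
    \<comment> \<open>The value of the product functional \<open>\<sigma>\<close> on the all-ones
      tensor factors over the copies.\<close>
    have "(\<Prod>d<r. \<Sum>t\<in>triples. neg_on (\<sigma> d) t) \<noteq> 0"
      using \<sigma> sum_neg_on_even_subset_neq_0[OF card_triples] by auto
    also have "(\<Prod>d<r. \<Sum>t\<in>triples. neg_on (\<sigma> d) t) = (\<Sum>\<pi>\<in>?R. ?w \<pi>)"
      by (rule prod_sum_PiE) auto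
    finally have "(\<Sum>\<pi>\<in>?R. ?w \<pi>) \<noteq> 0" .
    moreover have "real_of_int (\<Sum>\<pi>\<in>?R. ?w \<pi>) =
        (\<Sum>i<k. c i * real_of_int (order_sign * (\<Prod>d<r. \<Sum>t\<in>triples. neg_on (\<sigma> d) t * g i d t)))"
    proof -
      \<comment> \<open>Each coordinate 1 of the all-ones tensor is replaced by the linear equation
        of its perfect matching.\<close>
      have "real_of_int (\<Sum>\<pi>\<in>?R. ?w \<pi>) =
          (\<Sum>\<pi>\<in>?R. real_of_int (?w \<pi>) * (\<Sum>i<k. c i * real_of_int (pfaffian_sign (D i) (copies_matching r \<pi>))))"
        using c perfect_matching_copies_matching by (simp add: PiE_def Pi_def)
      also have "\<dots> = (\<Sum>\<pi>\<in>?R. \<Sum>i<k.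
          c i * real_of_int (order_sign * (\<Prod>d<r. neg_on (\<sigma> d) (\<pi> d) * g i d (\<pi> d))))"
        unfolding sum_distrib_left
      proof (intro sum.cong refl)
        fix \<pi> i assume "\<pi> \<in> ?R"
        then have "pfaffian_sign (D i) (copies_matching r \<pi>) = order_sign * (\<Prod>d<r. g i d (\<pi> d))"
          unfolding g_def by (intro pfaffian_sign_copies_matching) auto
        then show "real_of_int (?w \<pi>) * (c i * real_of_int (pfaffian_sign (D i) (copies_matching r \<pi>))) =
            c i * real_of_int (order_sign * (\<Prod>d<r. neg_on (\<sigma> d) (\<pi> d) * g i d (\<pi> d)))"
          by (simp add: prod.distrib)
      qed
      also have "\<dots> = (\<Sum>i<k. \<Sum>\<pi>\<in>?R.
          c i * real_of_int (order_sign * (\<Prod>d<r. neg_on (\<sigma> d) (\<pi> d) * g i d (\<pi> d))))"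
        by (rule sum.swap)
      also have "\<dots> = (\<Sum>i<k. c i * real_of_int (order_sign *
          (\<Sum>\<pi>\<in>?R. \<Prod>d<r. neg_on (\<sigma> d) (\<pi> d) * g i d (\<pi> d))))"
        by (simp add: sum_distrib_left)
      also have "\<dots> = (\<Sum>i<k. c i * real_of_int (order_sign *
          (\<Prod>d<r. \<Sum>t\<in>triples. neg_on (\<sigma> d) t * g i d t)))"
        by (subst prod_sum_PiE) auto
      finally show ?thesis .
    qed
    ultimately have "(\<Sum>i<k. c i * real_of_int (order_sign *
        (\<Prod>d<r. \<Sum>t\<in>triples. neg_on (\<sigma> d) t * g i d t))) \<noteq> 0"
      by linarith
    \<comment> \<open>A nonzero sum has a nonzero term, and all factors of that term are nonzero, so
      \<open>\<sigma> d\<close> lies in \<open>Z i d\<close> for every copy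
      \<open>d\<close>.\<close>
    then obtain i where "i < k" "(\<Prod>d<r. \<Sum>t\<in>triples. neg_on (\<sigma> d) t * g i d t) \<noteq> 0"
      by (metis (no_types, lifting) lessThan_iff mult_zero_right of_int_0 sum.neutral)
    then show "\<sigma> \<in> (\<Union>i<k. PiE {..<r} (Z i))"
      using \<sigma> by (auto simp: Z_def PiE_iff intro!: bexI[of _ i])
  qed
  moreover have "finite (\<Union>i<k. PiE {..<r} (Z i))"
    by (auto intro!: finite_PiE simp: Z_def)
  ultimately have "card (PiE {..<r} (\<lambda>_. even_subsets triples)) \<le> card (\<Union>i<k. PiE {..<r} (Z i))"
    by (intro card_mono)
  also have "\<dots> \<le> (\<Sum>i<k. card (PiE {..<r} (Z i)))"
    by (rule card_UN_le) simp
  also have "\<dots> \<le> (\<Sum>i<k. 12 ^ r)"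
  proof (rule sum_mono)
    fix i
    have "card (Z i d) \<le> 12" if "d < r" for d
      unfolding Z_def using card_triples g_abs g_prod[OF that]
      by (rule card_nonorthogonal_even_subsets)
    then have "(\<Prod>d<r. card (Z i d)) \<le> (\<Prod>d<r. 12)"
      by (intro prod_mono) auto
    then show "card (PiE {..<r} (Z i)) \<le> 12 ^ r"
      by (simp add: card_PiE)
  qed
  finally have "32 ^ r \<le> k * 12 ^ r"
    by (simp add: card_PiE card_even_subsets_6 card_triples)
  then have "real (32 ^ r) \<le> real (k * 12 ^ r)"
    by (simp only: of_nat_le_iff)
  then have "(32::real) ^ r \<le> real k * 12 ^ r"
    by simp
  \<comment> \<open>The quotient 32/12 of the two counts is the constant 8/3.\<close>
  then have "(32 / 12 :: real) ^ r \<le> real k"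
    unfolding power_divide by (subst pos_divide_le_eq) simp_all
  then show ?thesis by simp
qed

end

theorem theorem4p1:
  fixes r :: nat and vs :: "(nat \<times> (nat + nat)) list"
  assumes "r \<ge> 1"
    and "is_vertex_ordering (disjoint_copies r (complete_bipartite 3 3)) vs"
  shows "int (pfaffian_number (disjoint_copies r (complete_bipartite 3 3)) vs)
           \<ge> \<lceil>(8 / 3 :: real) ^ r\<rceil>"
proof -
  let ?G = "disjoint_copies r (complete_bipartite 3 3)"
  interpret k33_copies r vs
  proof
    show "finite_simple_graph ?G"
      by (intro finite_simple_graph_disjoint_copies finite_simple_graph_complete_bipartite)
    have "length vs = card (vertices ?G)"
      using assms(2) distinct_card[of vs] by (simp add: is_vertex_ordering_def)
    also have "\<dots> = r * 6"
      unfolding vertices_copies by (simp add: card_cartesian_product)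
    finally show "length vs = 2 * (3 * r)" by simp
  qed (rule assms(2))
  \<comment> \<open>Existence of some positive \<open>k\<close> ensures that the least one is
    attained, so the bound applies to it.\<close>
  have "k_pfaffian ?G vs (pfaffian_number ?G vs)"
    unfolding pfaffian_number_def using LeastI_ex[OF ex_k_pfaffian] by blast
  then show ?thesis
    using k_pfaffian_lower_bound by (simp add: ceiling_le_iff)
qed

end
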